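(* Let $k\ge1$, let $(V,g)$ be a $4k$-dimensional scalar product space and let $\theta\in O(V,g)$ with $\det(\theta)=-1$. Suppose that $C$ is an algebraic curvature tensor on $V$ that is $\theta$-even or $\theta$-odd. Then for all multi-indices $\alpha=(\alpha_1,\ldots,\alpha_l)$ of positive integers with $\alpha_1+\cdots+\alpha_l=k$, $$\varpi_\alpha(C):=\varpi_{\alpha_1}(C)\wedge\cdots\wedge\varpi_{\alpha_l}(C)=0\in\wedge^{4k}V^*.$$
   Context: A scalar product space $(V,g)$ is a finite-dimensional real vector space with a nondegenerate symmetric bilinear form $g$ (any signature). $O(V,g)=\{T\in\mathrm{End}(V):T^*g=g\}$ is its group of linear isometries. An algebraic curvature tensor on $V$ is a $(0,4)$-tensor $C$ with $C(u,v,x,y)=-C(v,u,x,y)=-C(u,v,y,x)$, $C(u,v,x,y)=C(x,y,u,v)$ and $C(u,v,x,y)+C(x,u,v,y)+C(v,x,u,y)=0$ for all $u,v,x,y\in V$. For $\theta\in O(V,g)$, $\theta^*C(u,x,y,z)=C(\theta u,\theta x,\theta y,\theta z)$. $C$ is $\theta$-even if $\theta^*C=C$ and $\theta$-odd if $\theta^*C=-C$. Pontryagin forms, with $n=\dim V$: view $C$ as a $(1,3)$-tensor via $g(C(u,v)x,y)=C(u,v,x,y)$; for a basis $(e_i)$ of $V$ the curvature matrix $\Omega_C=(\Omega_i{}^j)$ of 2-forms $\Omega_i{}^j\in\wedge^2V^*$ is given by $C(u,v)e_i=\sum_j\Omega_i{}^j(u,v)e_j$. Let $\sigma^{(n)}_m$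 be the polynomials on $n\times n$ matrices defined by $\det(I+tX)=1+\sum_{m=1}^n t^m\sigma^{(n)}_m(X)$. For $1\le j\le\lfloor n/2\rfloor$, $\varpi_j(C)=\frac{1}{(2\pi)^{2j}}\sigma^{(n)}_{2j}(\Omega_C)\in\wedge^{4j}V^*$, where products of entries are wedge products; this does not depend on the basis. *)

theory Defs
  imports Complex_Main "Jordan_Normal_Form.Determinant"
begin

section \<open>The even part of the exterior algebra of the dual space\<close>

text \<open>
  A form on \<open>V\<close> is represented by its evaluation on lists of vectors; the restriction to lists of
  length \<open>p\<close> is the component in \<open>\<And>\<^sup>p V\<^sup>*\<close>.  For finite-dimensional \<open>V\<close> the components of degree
  \<open>> dim V\<close> vanish automatically, so that these functions are exactly the elements of the exterior
  algebra \<open>\<And>V\<^sup>* = \<Oplus>\<^sub>p \<And>\<^sup>p V\<^sup>*\<close>.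
\<close>

definition multilinear_form :: "('v::real_vector list \<Rightarrow> real) \<Rightarrow> bool" where
  "multilinear_form f \<longleftrightarrow> (\<forall>xs ys. linear (\<lambda>v. f (xs @ v # ys)))"

definition alternating_form :: "('v::real_vector list \<Rightarrow> real) \<Rightarrow> bool" where
  "alternating_form f \<longleftrightarrow> multilinear_form f \<and> (\<forall>vs. \<not> distinct vs \<longrightarrow> f vs = 0)"

text \<open>
  The wedge product as a sum over shuffles: a \<open>(p,q)\<close>-shuffle is given by the \<open>p\<close>-element set \<open>S\<close> of
  argument positions passed to the first factor, and its sign is the parity of the number of
  inversions.
\<close>

definition shuffle_sign :: "nat set \<Rightarrow> nat set \<Rightarrow> real" where
  "shuffle_sign S T = (- 1) ^ card {(i, j). i \<in> S \<and> j \<in> T \<and> j < i}"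

definition wedge :: "('v list \<Rightarrow> real) \<Rightarrow> ('v list \<Rightarrow> real) \<Rightarrow> 'v list \<Rightarrow> real" where
  "wedge f h vs =
     (\<Sum>S\<in>Pow {..<length vs}. shuffle_sign S ({..<length vs} - S)
        * f (nths vs S) * h (nths vs ({..<length vs} - S)))"

definition unit_form :: "'v list \<Rightarrow> real" where
  "unit_form vs = (if vs = [] then 1 else 0)"

subsection \<open>Recursive description of the wedge product\<close>

definition contract :: "'v \<Rightarrow> ('v list \<Rightarrow> real) \<Rightarrow> 'v list \<Rightarrow> real" where
  "contract v f vs = f (v # vs)"

definition grade_inv :: "('v list \<Rightarrow> real) \<Rightarrow> 'v list \<Rightarrow> real" where
  "grade_inv f vs = (- 1) ^ length vs * f vs"

lemma wedge_Nil: "wedge f h [] = f [] * h []"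
  by (simp add: wedge_def shuffle_sign_def)

lemma nths_Suc_image: "nths (v # vs) (Suc ` S) = nths vs S"
proof -
  have "{j. Suc j \<in> Suc ` S} = S" by auto
  then show ?thesis by (simp add: nths_Cons)
qed

lemma nths_insert0_image: "nths (v # vs) (insert 0 (Suc ` S)) = v # nths vs S"
proof -
  have "{j. Suc j \<in> insert 0 (Suc ` S)} = S" by auto
  then show ?thesis by (simp add: nths_Cons)
qed

lemma shuffle_sign_insert_left:
  "shuffle_sign (insert 0 (Suc ` S)) (Suc ` T) = shuffle_sign S T"
proof -
  have "{(i, j). i \<in> insert 0 (Suc ` S) \<and> j \<in> Suc ` T \<and> j < i}
      = (\<lambda>(i, j). (Suc i, Suc j)) ` {(i, j). i \<in> S \<and> j \<in> T \<and> j < i}"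
    by auto
  moreover have "inj_on (\<lambda>(i, j). (Suc i, Suc j)) {(i, j). i \<in> S \<and> j \<in> T \<and> j < i}"
    by (auto simp: inj_on_def)
  ultimately show ?thesis by (simp add: shuffle_sign_def card_image)
qed

lemma shuffle_sign_insert_right:
  assumes "finite S" "finite T"
  shows "shuffle_sign (Suc ` S) (insert 0 (Suc ` T)) = (- 1) ^ card S * shuffle_sign S T"
proof -
  let ?A = "(\<lambda>(i, j). (Suc i, Suc j)) ` {(i, j). i \<in> S \<and> j \<in> T \<and> j < i}"
  let ?B = "(\<lambda>i. (Suc i, 0 :: nat)) ` S"
  have "{(i, j). i \<in> Suc ` S \<and> j \<in> insert 0 (Suc ` T) \<and> j < i} = ?B \<union> ?A"
    by auto
  moreover have fin: "finite {(i, j). i \<in> S \<and> j \<in> T \<and> j < i}"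
    by (rule finite_subset[of _ "S \<times> T"]) (use assms in auto)
  have "card (?B \<union> ?A) = card ?B + card ?A"
    by (rule card_Un_disjoint) (use assms(1) fin in auto)
  moreover have "card ?B = card S"
    by (rule card_image) (auto simp: inj_on_def)
  moreover have "card ?A = card {(i, j). i \<in> S \<and> j \<in> T \<and> j < i}"
    by (rule card_image) (auto simp: inj_on_def)
  ultimately show ?thesis by (simp add: shuffle_sign_def power_add)
qed

lemma Pow_lessThan_Suc:
  "Pow {..<Suc n} = (\<lambda>S. insert 0 (Suc ` S)) ` Pow {..<n} \<union> (\<lambda>S. Suc ` S) ` Pow {..<n}"
proof (rule subset_antisym; rule subsetI)
  fix S assume S: "S \<in> Pow {..<Suc n}"
  define S' where "S' = {j. Suc j \<in> S}"
  have S': "S' \<in> Pow {..<n}" using S by (auto simp: S'_def)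
  show "S \<in> (\<lambda>S. insert 0 (Suc ` S)) ` Pow {..<n} \<union> (\<lambda>S. Suc ` S) ` Pow {..<n}"
  proof (cases "0 \<in> S")
    case True
    have "S = insert 0 (Suc ` S')"
      using True by (auto simp: S'_def image_iff) (metis not0_implies_Suc)
    then show ?thesis using S' by blast
  next
    case False
    have "S = Suc ` S'"
      using False by (auto simp: S'_def image_iff) (metis not0_implies_Suc)
    then show ?thesis using S' by blast
  qed
qed auto

lemma inj_insert0_Suc: "inj_on (\<lambda>S. insert 0 (Suc ` S)) A"
proof (rule inj_onI)
  fix S T assume eq: "insert 0 (Suc ` S) = insert 0 (Suc ` T)"
  have "{j. Suc j \<in> insert 0 (Suc ` S)} = {j. Suc j \<in> insert 0 (Suc ` T)}"
    by (simp only: eq)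
  then show "S = T" by auto
qed

lemma length_nths_sub: "S \<subseteq> {..<length vs} \<Longrightarrow> length (nths vs S) = card S"
  by (simp add: length_nths) (metis (no_types, lifting) Collect_cong Collect_mem_eq lessThan_iff subset_eq)

lemma wedge_Cons:
  "wedge f h (v # vs) = wedge (contract v f) h vs + wedge (grade_inv f) (contract v h) vs"
proof -
  let ?n = "length vs"
  let ?N = "{..<length (v # vs)}"
  let ?F = "\<lambda>S. shuffle_sign S (?N - S) * f (nths (v # vs) S) * h (nths (v # vs) (?N - S))"
  have N: "?N = insert 0 (Suc ` {..<?n})"
    by (simp add: lessThan_Suc_eq_insert_0)
  have c1: "?N - insert 0 (Suc ` S) = Suc ` ({..<?n} - S)" for S
    unfolding N by blast
  have c2: "?N - Suc ` S = insert 0 (Suc ` ({..<?n} - S))" for S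
    unfolding N by blast
  have "wedge f h (v # vs) = (\<Sum>S\<in>Pow ?N. ?F S)"
    by (simp add: wedge_def)
  also have "\<dots> = (\<Sum>S\<in>(\<lambda>S. insert 0 (Suc ` S)) ` Pow {..<?n}. ?F S)
                + (\<Sum>S\<in>(\<lambda>S. Suc ` S) ` Pow {..<?n}. ?F S)"
    unfolding length_Cons Pow_lessThan_Suc by (rule sum.union_disjoint) auto
  also have "(\<Sum>S\<in>(\<lambda>S. insert 0 (Suc ` S)) ` Pow {..<?n}. ?F S)
           = (\<Sum>S\<in>Pow {..<?n}. ?F (insert 0 (Suc ` S)))"
    by (subst sum.reindex[OF inj_insert0_Suc]) simp
  also have "\<dots> = wedge (contract v f) h vs"
    unfolding wedge_def
    by (rule sum.cong)
      (simp_all only: c1 shuffle_sign_insert_left nths_insert0_image nths_Suc_image contract_def)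
  also have "(\<Sum>S\<in>(\<lambda>S. Suc ` S) ` Pow {..<?n}. ?F S) = (\<Sum>S\<in>Pow {..<?n}. ?F (Suc ` S))"
    by (subst sum.reindex) (auto intro!: inj_onI dest: inj_image_eq_iff[OF inj_Suc, THEN iffD1])
  also have "\<dots> = wedge (grade_inv f) (contract v h) vs"
    unfolding wedge_def
  proof (rule sum.cong[OF refl])
    fix S assume "S \<in> Pow {..<?n}"
    then have S: "S \<subseteq> {..<?n}" by simp
    then have fin: "finite S" by (rule finite_subset) simp
    show "?F (Suc ` S) = shuffle_sign S ({..<?n} - S) * grade_inv f (nths vs S)
            * contract v h (nths vs ({..<?n} - S))"
      unfolding c2 shuffle_sign_insert_right[OF fin finite_Diff[OF finite_lessThan]]
        nths_insert0_image nths_Suc_image contract_def grade_inv_def length_nths_sub[OF S]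
      by simp
  qed
  finally show ?thesis .
qed

lemma wedge_add_left: "wedge (\<lambda>x. f x + f' x) h vs = wedge f h vs + wedge f' h vs"
  by (simp add: wedge_def algebra_simps sum.distrib)

lemma wedge_add_right: "wedge f (\<lambda>x. h x + h' x) vs = wedge f h vs + wedge f h' vs"
  by (simp add: wedge_def algebra_simps sum.distrib)

lemma wedge_scale_left: "wedge (\<lambda>x. c * f x) h vs = c * wedge f h vs"
  by (simp add: wedge_def algebra_simps sum_distrib_left)

lemma wedge_scale_right: "wedge f (\<lambda>x. c * h x) vs = c * wedge f h vs"
  by (simp add: wedge_def algebra_simps sum_distrib_left)

lemma wedge_zero_left: "wedge (\<lambda>x. 0) h vs = 0"
  by (simp add: wedge_def)

lemma wedge_zero_right: "wedge f (\<lambda>x. 0) vs = 0"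
  by (simp add: wedge_def)

lemma contract_wedge:
  "contract v (wedge f h) = (\<lambda>vs. wedge (contract v f) h vs + wedge (grade_inv f) (contract v h) vs)"
  by (rule ext) (simp only: contract_def[of v "wedge f h"] wedge_Cons)

lemma contract_grade_inv: "contract v (grade_inv f) = (\<lambda>vs. (- 1) * grade_inv (contract v f) vs)"
  by (rule ext) (simp add: contract_def grade_inv_def)

lemma grade_inv_grade_inv: "grade_inv (grade_inv f) = f"
  by (rule ext) (simp add: grade_inv_def power_add[symmetric] flip: mult.assoc)

lemma grade_inv_even: "\<forall>xs. odd (length xs) \<longrightarrow> f xs = 0 \<Longrightarrow> grade_inv f = f"
proof (rule ext)
  fix xs assume "\<forall>xs. odd (length xs) \<longrightarrow> f xs = 0"
  then show "grade_inv f xs = f xs"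
    by (cases "even (length xs)") (simp_all add: grade_inv_def)
qed

lemma grade_inv_odd:
  "\<forall>xs. even (length xs) \<longrightarrow> f xs = 0 \<Longrightarrow> grade_inv f = (\<lambda>x. (- 1) * f x)"
proof (rule ext)
  fix xs assume "\<forall>xs. even (length xs) \<longrightarrow> f xs = 0"
  then show "grade_inv f xs = (- 1) * f xs"
    by (cases "even (length xs)") (simp_all add: grade_inv_def)
qed

lemma grade_inv_wedge: "grade_inv (wedge f h) vs = wedge (grade_inv f) (grade_inv h) vs"
proof -
  have "(- 1::real) ^ length vs = (- 1) ^ length (nths vs S) * (- 1) ^ length (nths vs ({..<length vs} - S))"
    if "S \<in> Pow {..<length vs}" for S
  proof -
    from that have S: "S \<subseteq> {..<length vs}" by simp
    then have "finite S" by (rule finite_subset) simp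
    then have "card S + card ({..<length vs} - S) = length vs"
      using S by (metis add_diff_inverse_nat card_Diff_subset card_lessThan card_mono
          finite_lessThan leD)
    then show ?thesis
      using S by (simp add: length_nths_sub power_add[symmetric])
  qed
  then show ?thesis
    unfolding grade_inv_def wedge_def sum_distrib_left
    by (intro sum.cong[OF refl]) (simp only: mult_ac)
qed

lemma wedge_assoc: "wedge (wedge f h) k vs = wedge f (wedge h k) vs"
proof (induction vs arbitrary: f h k)
  case Nil
  show ?case by (simp add: wedge_Nil)
next
  case (Cons v vs)
  have "wedge (grade_inv (wedge f h)) (contract v k) vs
      = wedge (wedge (grade_inv f) (grade_inv h)) (contract v k) vs"
    by (rule arg_cong[where f = "\<lambda>F. wedge F (contract v k) vs"]) (rule ext, rule grade_inv_wedge)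
  then show ?case
    by (simp add: wedge_Cons contract_wedge wedge_add_left wedge_add_right Cons.IH)
qed

lemma wedge_unit_left: "wedge unit_form f vs = f vs"
proof (induction vs arbitrary: f)
  case Nil
  show ?case by (simp add: wedge_Nil unit_form_def)
next
  case (Cons v vs)
  have "contract v unit_form = (\<lambda>x. 0)" "grade_inv (unit_form :: 'a list \<Rightarrow> real) = unit_form"
    by (auto simp: contract_def unit_form_def grade_inv_def)
  then show ?case by (simp only: wedge_Cons wedge_zero_left Cons.IH) (simp add: contract_def)
qed

lemma wedge_swap_even:
  assumes "\<And>xs. odd (length xs) \<Longrightarrow> f xs = 0"
  shows "wedge f h vs = wedge h f vs"
proof -
  have "(\<forall>xs. odd (length xs) \<longrightarrow> f xs = 0) \<longrightarrow> wedge f h vs = wedge h f vs"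
       "(\<forall>xs. even (length xs) \<longrightarrow> f xs = 0) \<longrightarrow> wedge f h vs = wedge (grade_inv h) f vs"
    for f h :: "'a list \<Rightarrow> real" and vs
  proof (induction vs arbitrary: f h)
    case Nil
    { case 1 show ?case by (simp add: wedge_Nil) }
    { case 2 show ?case by (simp add: wedge_Nil) }
  next
    case (Cons v vs)
    { case 1
      show ?case
      proof
        assume f: "\<forall>xs. odd (length xs) \<longrightarrow> f xs = 0"
        then have g: "grade_inv f = f" by (rule grade_inv_even)
        have "\<forall>xs. even (length xs) \<longrightarrow> contract v f xs = 0"
          using f by (auto simp: contract_def)
        then have "wedge (contract v f) h vs = wedge (grade_inv h) (contract v f) vs"
          using Cons.IH(2) by blast
        moreover have "wedge f (contract v h) vs = wedge (contract v h) f vs"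
          using f Cons.IH(1) by blast
        ultimately show "wedge f h (v # vs) = wedge h f (v # vs)"
          by (simp add: wedge_Cons g)
      qed }
    { case 2
      show ?case
      proof
        assume f: "\<forall>xs. even (length xs) \<longrightarrow> f xs = 0"
        then have g: "grade_inv f = (\<lambda>x. (- 1) * f x)" by (rule grade_inv_odd)
        have "\<forall>xs. odd (length xs) \<longrightarrow> contract v f xs = 0"
          using f by (auto simp: contract_def)
        then have "wedge (contract v f) h vs = wedge h (contract v f) vs"
          using Cons.IH(1) by blast
        moreover have "wedge f (contract v h) vs = wedge (grade_inv (contract v h)) f vs"
          using f Cons.IH(2) by blast
        ultimately show "wedge f h (v # vs) = wedge (grade_inv h) f (v # vs)"
          unfolding wedge_Cons contract_grade_inv g wedge_scale_left grade_inv_grade_inv by simp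
      qed }
  qed
  then show ?thesis using assms by blast
qed

subsection \<open>The wedge product of alternating forms is alternating\<close>

lemma linear_scaled_add:
  shows "linear (f :: 'v::real_vector \<Rightarrow> real) \<Longrightarrow> linear h \<Longrightarrow> linear (\<lambda>v. f v + h v)"
    and "linear f \<Longrightarrow> linear (\<lambda>v. c * f v)"
    and "linear f \<Longrightarrow> linear (\<lambda>v. f v * c)"
  by (auto simp: linear_iff algebra_simps)

lemma multilinear_formD: "multilinear_form f \<Longrightarrow> linear (\<lambda>v. f (xs @ v # ys))"
  by (simp add: multilinear_form_def)

lemma multilinear_contract:
  assumes "multilinear_form f"
  shows "multilinear_form (contract v f)"
  unfolding multilinear_form_def
proof (intro allI)
  fix xs ys
  show "linear (\<lambda>w. contract v f (xs @ w # ys))"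
    using multilinear_formD[OF assms, of "v # xs" ys] by (simp add: contract_def)
qed

lemma multilinear_grade_inv: "multilinear_form f \<Longrightarrow> multilinear_form (grade_inv f)"
  unfolding multilinear_form_def grade_inv_def length_append length_Cons
  by (intro allI linear_scaled_add(2)) simp

lemma multilinear_wedge:
  assumes "multilinear_form f" "multilinear_form h"
  shows "multilinear_form (wedge f h)"
proof -
  have "multilinear_form f \<Longrightarrow> multilinear_form h \<Longrightarrow> linear (\<lambda>v. wedge f h (xs @ v # ys))"
    for f h :: "'a list \<Rightarrow> real" and xs ys
  proof (induction xs arbitrary: f h)
    case Nil
    have l: "linear (\<lambda>v. contract v f zs)" "linear (\<lambda>v. contract v h zs)" for zs
      using multilinear_formD[OF Nil(1), of "[]" zs] multilinear_formD[OF Nil(2), of "[]" zs]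
      by (simp_all add: contract_def)
    have "linear (\<lambda>v. wedge (contract v f) h ys)"
         "linear (\<lambda>v. wedge (grade_inv f) (contract v h) ys)"
      unfolding wedge_def
      by (auto intro!: linear_compose_sum linear_scaled_add l)
    then show ?case by (auto simp: wedge_Cons intro: linear_scaled_add)
  next
    case (Cons a xs)
    have "linear (\<lambda>v. wedge (contract a f) h (xs @ v # ys))"
         "linear (\<lambda>v. wedge (grade_inv f) (contract a h) (xs @ v # ys))"
      using Cons by (auto intro: multilinear_contract multilinear_grade_inv)
    then show ?case by (auto simp: wedge_Cons intro: linear_scaled_add)
  qed
  then show ?thesis using assms by (simp add: multilinear_form_def)
qed

text \<open>Vanishing on lists with two \<^emph>\<open>adjacent\<close> equal entries suffices.\<close>

lemma alternating_form_adjacent: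
  "alternating_form f \<longleftrightarrow> multilinear_form f \<and> (\<forall>xs v ys. f (xs @ v # v # ys) = 0)"
proof
  assume "alternating_form f"
  then show "multilinear_form f \<and> (\<forall>xs v ys. f (xs @ v # v # ys) = 0)"
    by (auto simp: alternating_form_def)
next
  assume asm: "multilinear_form f \<and> (\<forall>xs v ys. f (xs @ v # v # ys) = 0)"
  then have m: "multilinear_form f" and z: "f (xs @ v # v # ys) = 0" for xs v ys by auto
  have swap: "f (xs @ a # b # ys) = - f (xs @ b # a # ys)" for xs a b ys
  proof -
    have l1: "linear (\<lambda>v. f (xs @ v # w # ys))" for w
      using m by (simp add: multilinear_form_def)
    have l2: "linear (\<lambda>v. f (xs @ w # v # ys))" for w
      using m[unfolded multilinear_form_def, rule_format, of "xs @ [w]" ys] by simp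
    have "0 = f (xs @ (a + b) # (a + b) # ys)" by (simp add: z)
    also have "\<dots> = f (xs @ a # (a + b) # ys) + f (xs @ b # (a + b) # ys)"
      using linear_add[OF l1] by simp
    also have "\<dots> = f (xs @ a # b # ys) + f (xs @ b # a # ys)"
      using linear_add[OF l2] by (simp add: z)
    finally show ?thesis by simp
  qed
  have "f (xs @ v # zs @ v # ys) = 0" for xs v zs ys
  proof (induction zs arbitrary: xs)
    case Nil
    show ?case by (simp add: z)
  next
    case (Cons a zs)
    show ?case using swap[of xs v a "zs @ v # ys"] Cons.IH[of "xs @ [a]"] by simp
  qed
  then have "f vs = 0" if "\<not> distinct vs" for vs
    using not_distinct_decomp[OF that] by (elim exE) simp
  with m show "alternating_form f" by (simp add: alternating_form_def)
qed

lemma alternating_contract: "alternating_form f \<Longrightarrow> alternating_form (contract v f)"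
  by (simp add: alternating_form_def multilinear_contract) (simp add: contract_def)

lemma alternating_grade_inv: "alternating_form f \<Longrightarrow> alternating_form (grade_inv f)"
  by (simp add: alternating_form_def multilinear_grade_inv) (simp add: grade_inv_def)

lemma alternating_wedge:
  assumes "alternating_form f" "alternating_form h"
  shows "alternating_form (wedge f h)"
proof -
  have "alternating_form f \<Longrightarrow> alternating_form h \<Longrightarrow> wedge f h (xs @ v # v # ys) = 0"
    for f h :: "'a list \<Rightarrow> real" and xs v ys
  proof (induction xs arbitrary: f h)
    case Nil
    have "contract v (contract v f) = (\<lambda>x. 0)" "contract v (contract v h) = (\<lambda>x. 0)"
      using Nil by (auto simp: alternating_form_def contract_def)
    then show ?case
      unfolding append_Nil wedge_Cons contract_grade_inv wedge_scale_left
      by (simp add: wedge_zero_left wedge_zero_right)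
  next
    case (Cons a xs)
    then show ?case
      by (simp add: wedge_Cons alternating_contract alternating_grade_inv)
  qed
  then show ?thesis
    using assms multilinear_wedge by (auto simp: alternating_form_adjacent)
qed

subsection \<open>The commutative algebra of even forms\<close>

typedef (overloaded) 'v even_form =
  "{f :: 'v::real_vector list \<Rightarrow> real. alternating_form f \<and> (\<forall>vs. odd (length vs) \<longrightarrow> f vs = 0)}"
  morphisms eval_form Even_Form
  by (rule exI[of _ "\<lambda>_. 0"]) (auto simp: alternating_form_def multilinear_form_def linear_iff)

lemma alternating_eval_form: "alternating_form (eval_form \<omega>)"
  using eval_form[of \<omega>] by simp

lemma eval_form_odd: "odd (length vs) \<Longrightarrow> eval_form \<omega> vs = 0"
  using eval_form[of \<omega>] by simp

lemma even_form_eqI: "(\<And>vs. eval_form a vs = eval_form b vs) \<Longrightarrow> a = b"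
  by (metis eval_form_inject ext)

lemma wedge_even:
  assumes "\<And>xs. odd (length xs) \<Longrightarrow> f xs = 0" "\<And>xs. odd (length xs) \<Longrightarrow> h xs = 0"
    and "odd (length vs)"
  shows "wedge f h vs = 0"
proof -
  have "grade_inv f = f" "grade_inv h = h"
    using assms by (auto intro: grade_inv_even)
  then have "grade_inv (wedge f h) vs = wedge f h vs"
    by (simp add: grade_inv_wedge)
  then show ?thesis using assms(3) by (simp add: grade_inv_def)
qed

instantiation even_form :: (real_vector) real_algebra_1
begin

definition "0 = Even_Form (\<lambda>_. 0)"
definition "1 = Even_Form unit_form"
definition "a + b = Even_Form (\<lambda>vs. eval_form a vs + eval_form b vs)"
definition "- a = Even_Form (\<lambda>vs. - eval_form a vs)"
definition "a - b = Even_Form (\<lambda>vs. eval_form a vs - eval_form b vs)"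
definition "c *\<^sub>R a = Even_Form (\<lambda>vs. c * eval_form a vs)"
definition "a * b = Even_Form (wedge (eval_form a) (eval_form b))"

lemma eval_form_zero: "eval_form 0 vs = 0"
  unfolding zero_even_form_def
  by (subst Even_Form_inverse) (auto simp: alternating_form_def multilinear_form_def linear_iff)

lemma eval_form_one: "eval_form 1 vs = unit_form vs"
  unfolding one_even_form_def
  by (subst Even_Form_inverse)
    (auto simp: alternating_form_def multilinear_form_def linear_iff unit_form_def)

lemma alternating_linear:
  "alternating_form f \<Longrightarrow> linear (\<lambda>v. f (xs @ v # ys))"
  "alternating_form f \<Longrightarrow> \<not> distinct vs \<Longrightarrow> f vs = 0"
  by (auto simp: alternating_form_def multilinear_form_def)

lemma eval_form_add: "eval_form (a + b) vs = eval_form a vs + eval_form b vs"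
  unfolding plus_even_form_def
  using alternating_linear[OF alternating_eval_form[of a]]
    alternating_linear[OF alternating_eval_form[of b]]
  by (subst Even_Form_inverse)
    (auto simp: alternating_form_def multilinear_form_def eval_form_odd intro: linear_scaled_add)

lemma eval_form_scaleR: "eval_form (c *\<^sub>R a) vs = c * eval_form a vs"
  unfolding scaleR_even_form_def
  using alternating_linear[OF alternating_eval_form[of a]]
  by (subst Even_Form_inverse)
    (auto simp: alternating_form_def multilinear_form_def eval_form_odd intro: linear_scaled_add)

lemma eval_form_uminus: "eval_form (- a) vs = - eval_form a vs"
proof -
  have "- a = (- 1) *\<^sub>R a" by (simp add: uminus_even_form_def scaleR_even_form_def)
  then show ?thesis by (simp add: eval_form_scaleR)
qed

lemma eval_form_diff: "eval_form (a - b) vs = eval_form a vs - eval_form b vs"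
proof -
  have "a - b = a + (- b)"
    by (simp add: minus_even_form_def plus_even_form_def eval_form_uminus)
  then show ?thesis by (simp add: eval_form_add eval_form_uminus)
qed

lemma eval_form_times_fun: "eval_form (a * b) = wedge (eval_form a) (eval_form b)"
  unfolding times_even_form_def
  by (rule Even_Form_inverse)
    (auto intro: alternating_wedge alternating_eval_form wedge_even eval_form_odd)

lemmas eval_form_simps = eval_form_zero eval_form_one eval_form_add eval_form_scaleR
  eval_form_uminus eval_form_diff eval_form_times_fun

lemma even_form_mult_commute: "a * b = b * (a :: 'a even_form)"
  by (rule even_form_eqI) (auto simp: eval_form_simps eval_form_odd intro: wedge_swap_even)

instance
proof
  fix a b c :: "'a even_form" and x y :: real
  have add_left: "eval_form (a + b) = (\<lambda>x. eval_form a x + eval_form b x)" for a b :: "'a even_form"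
    by (rule ext) (simp add: eval_form_add)
  have scale: "eval_form (x *\<^sub>R a) = (\<lambda>y. x * eval_form a y)" for x and a :: "'a even_form"
    by (rule ext) (simp add: eval_form_scaleR)
  have one: "eval_form 1 = (unit_form :: 'a list \<Rightarrow> real)"
    by (rule ext) (simp add: eval_form_one)
  show "(a * b) * c = a * (b * c)"
    by (rule even_form_eqI) (simp add: eval_form_times_fun wedge_assoc)
  show "(a + b) * c = a * c + b * c"
    by (rule even_form_eqI) (simp add: eval_form_times_fun eval_form_add add_left wedge_add_left)
  show "a * (b + c) = a * b + a * c"
    by (rule even_form_eqI) (simp add: eval_form_times_fun eval_form_add add_left wedge_add_right)
  show "(x *\<^sub>R a) * b = x *\<^sub>R (a * b)"
    by (rule even_form_eqI) (simp add: eval_form_times_fun eval_form_scaleR scale wedge_scale_left)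
  show "a * (x *\<^sub>R b) = x *\<^sub>R (a * b)"
    by (rule even_form_eqI) (simp add: eval_form_times_fun eval_form_scaleR scale wedge_scale_right)
  show l: "1 * a = a" for a :: "'a even_form"
    by (rule even_form_eqI) (simp add: eval_form_times_fun one wedge_unit_left)
  show "a * 1 = a"
    using l[of a] even_form_mult_commute[of a 1] by simp
  have "eval_form (0 :: 'a even_form) [] \<noteq> eval_form 1 []"
    by (simp add: eval_form_simps unit_form_def)
  then show "(0 :: 'a even_form) \<noteq> 1" by metis
qed (rule even_form_eqI; simp add: eval_form_simps algebra_simps)+

end

instance even_form :: (real_vector) comm_ring_1
  by standard (auto simp: even_form_mult_commute algebra_simps)

section \<open>Finite bases, coordinates and determinants of endomorphisms\<close>

text \<open>A basis \<open>(e\<^sub>0, \<dots>, e\<^bsub>n-1\<^esub>)\<close> is the restriction of \<open>e\<close> to \<open>{..<dim V}\<close>.\<close>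

definition is_basis :: "(nat \<Rightarrow> 'v::real_vector) \<Rightarrow> bool" where
  "is_basis e \<longleftrightarrow> inj_on e {..<dim (UNIV :: 'v set)} \<and> independent (e ` {..<dim (UNIV :: 'v set)})
     \<and> span (e ` {..<dim (UNIV :: 'v set)}) = UNIV"

definition coord :: "(nat \<Rightarrow> 'v::real_vector) \<Rightarrow> 'v \<Rightarrow> nat \<Rightarrow> real" where
  "coord e v j = representation (e ` {..<dim (UNIV :: 'v set)}) v (e j)"

definition some_basis :: "nat \<Rightarrow> 'v::real_vector" where
  "some_basis = (SOME e. is_basis e)"

text \<open>The determinant of an endomorphism is computed in \<open>some_basis\<close>;
  see \<open>endo_det_eq\<close> for the independence of the basis.\<close>

definition endo_matrix :: "(nat \<Rightarrow> 'v::real_vector) \<Rightarrow> ('v \<Rightarrow> 'v) \<Rightarrow> real mat" where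
  "endo_matrix e T =
     mat (dim (UNIV :: 'v set)) (dim (UNIV :: 'v set)) (\<lambda>(i, j). coord e (T (e j)) i)"

definition endo_det :: "('v::real_vector \<Rightarrow> 'v) \<Rightarrow> real" where
  "endo_det T = det (endo_matrix some_basis T)"

lemma is_basisD:
  fixes e :: "nat \<Rightarrow> 'v::real_vector"
  assumes "is_basis e"
  shows "inj_on e {..<dim (UNIV :: 'v set)}" "independent (e ` {..<dim (UNIV :: 'v set)})"
    "span (e ` {..<dim (UNIV :: 'v set)}) = UNIV"
  using assms by (auto simp: is_basis_def)

lemma is_basis_exists:
  assumes "finite (B :: 'v::real_vector set)" "span B = UNIV"
  shows "\<exists>e :: nat \<Rightarrow> 'v. is_basis e"
proof -
  obtain B' :: "'v set" where B': "independent B'" "UNIV \<subseteq> span B'" "card B' = dim (UNIV :: 'v set)"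
    using basis_exists by blast
  have "finite B'"
    using independent_span_bound[OF assms(1) B'(1)] assms(2) by simp
  then obtain e where e: "bij_betw e {0..<card B'} B'"
    using ex_bij_betw_nat_finite by blast
  then have "is_basis e"
    using B' by (auto simp: is_basis_def bij_betw_def lessThan_atLeast0)
  then show ?thesis by blast
qed

lemma is_basis_some_basis:
  assumes "finite (B :: 'v::real_vector set)" "span B = UNIV"
  shows "is_basis (some_basis :: nat \<Rightarrow> 'v)"
  unfolding some_basis_def using is_basis_exists[OF assms] by (rule someI_ex)

lemma linear_coord: "is_basis e \<Longrightarrow> linear (\<lambda>v. coord e v j)"
  by (simp add: linear_iff coord_def real_vector.representation_add
      real_vector.representation_scale is_basisD)

lemma coord_basis:
  fixes e :: "nat \<Rightarrow> 'v::real_vector"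
  assumes e: "is_basis e" and "i < dim (UNIV :: 'v set)" "j < dim (UNIV :: 'v set)"
  shows "coord e (e i) j = (if i = j then 1 else 0)"
proof -
  have "coord e (e i) j = (if e j = e i then 1 else 0)"
    unfolding coord_def using assms(2)
    by (subst real_vector.representation_basis[OF is_basisD(2)[OF e]]) auto
  also have "(e j = e i) = (i = j)"
    using inj_on_eq_iff[OF is_basisD(1)[OF e], of j i] assms(2,3) by auto
  finally show ?thesis .
qed

lemma coord_expand:
  fixes e :: "nat \<Rightarrow> 'v::real_vector"
  assumes e: "is_basis e"
  shows "v = (\<Sum>i<dim (UNIV :: 'v set). coord e v i *\<^sub>R e i)"
proof -
  let ?B = "e ` {..<dim (UNIV :: 'v set)}"
  have "v = (\<Sum>b\<in>?B. representation ?B v b *\<^sub>R b)"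
    using is_basisD[OF e] by (intro real_vector.sum_representation_eq[symmetric]) auto
  also have "\<dots> = (\<Sum>i<dim (UNIV :: 'v set). coord e v i *\<^sub>R e i)"
    by (subst sum.reindex[OF is_basisD(1)[OF e]]) (simp add: coord_def)
  finally show ?thesis .
qed

lemma coord_apply:
  fixes e :: "nat \<Rightarrow> 'v::real_vector"
  assumes e: "is_basis e" and L: "linear (L :: 'v \<Rightarrow> 'w::real_vector)"
  shows "L v = (\<Sum>i<dim (UNIV :: 'v set). coord e v i *\<^sub>R L (e i))"
proof -
  have "L (\<Sum>i<dim (UNIV :: 'v set). coord e v i *\<^sub>R e i)
      = (\<Sum>i<dim (UNIV :: 'v set). coord e v i *\<^sub>R L (e i))"
    by (simp only: linear_sum[OF L] linear_scale[OF L])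
  then show ?thesis by (simp only: coord_expand[OF e, of v, symmetric])
qed

lemma coord_change:
  fixes e e' :: "nat \<Rightarrow> 'v::real_vector"
  assumes "is_basis e" "is_basis e'"
  shows "coord e' v j = (\<Sum>l<dim (UNIV :: 'v set). coord e v l * coord e' (e l) j)"
  using coord_apply[OF assms(1) linear_coord[OF assms(2)], of v j] by simp

definition base_change :: "(nat \<Rightarrow> 'v::real_vector) \<Rightarrow> (nat \<Rightarrow> 'v) \<Rightarrow> real mat" where
  "base_change e e' =
     mat (dim (UNIV :: 'v set)) (dim (UNIV :: 'v set)) (\<lambda>(i, j). coord e (e' i) j)"

lemma base_change_carrier:
  fixes e e' :: "nat \<Rightarrow> 'v::real_vector"
  shows "base_change e e' \<in> carrier_mat (dim (UNIV :: 'v set)) (dim (UNIV :: 'v set))"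
  by (simp add: base_change_def)

lemma base_change_inverse:
  fixes e e' :: "nat \<Rightarrow> 'v::real_vector"
  assumes e: "is_basis e" and e': "is_basis e'"
  shows "base_change e e' * base_change e' e = 1\<^sub>m (dim (UNIV :: 'v set))"
proof (rule eq_matI)
  fix i j assume "i < dim_row (1\<^sub>m (dim (UNIV :: 'v set)))" "j < dim_col (1\<^sub>m (dim (UNIV :: 'v set)))"
  then have ij: "i < dim (UNIV :: 'v set)" "j < dim (UNIV :: 'v set)" by auto
  then have "(base_change e e' * base_change e' e) $$ (i, j)
      = (\<Sum>l<dim (UNIV :: 'v set). coord e (e' i) l * coord e' (e l) j)"
    by (simp add: base_change_def scalar_prod_def lessThan_atLeast0)
  also have "\<dots> = coord e' (e' i) j"
    by (rule coord_change[OF e e', symmetric])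
  finally show "(base_change e e' * base_change e' e) $$ (i, j) = 1\<^sub>m (dim (UNIV :: 'v set)) $$ (i, j)"
    using ij by (simp add: coord_basis[OF e'])
qed (simp_all add: base_change_def)

lemma endo_det_eq:
  fixes e :: "nat \<Rightarrow> 'v::real_vector"
  assumes e: "is_basis e" and T: "linear T"
  shows "endo_det T = det (endo_matrix e T)"
proof -
  let ?n = "dim (UNIV :: 'v set)"
  let ?s = "some_basis :: nat \<Rightarrow> 'v"
  have s: "is_basis ?s"
    unfolding some_basis_def by (rule someI[of is_basis, OF e])
  let ?P = "base_change e ?s" and ?Q = "base_change ?s e" and ?A = "endo_matrix e T"
  have P: "?P \<in> carrier_mat ?n ?n" and Q: "?Q \<in> carrier_mat ?n ?n"
    by (rule base_change_carrier)+
  have A: "?A \<in> carrier_mat ?n ?n" by (simp add: endo_matrix_def)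
  have "endo_matrix ?s T = transpose_mat ?Q * (?A * transpose_mat ?P)"
  proof (rule eq_matI)
    fix i j
    assume "i < dim_row (transpose_mat ?Q * (?A * transpose_mat ?P))"
      "j < dim_col (transpose_mat ?Q * (?A * transpose_mat ?P))"
    then have ij: "i < ?n" "j < ?n" by (auto simp: base_change_def)
    have lin: "linear (\<lambda>v. coord e (T v) l)" for l
      using linear_compose[OF T linear_coord[OF e, of l]] by (simp add: o_def)
    have "coord ?s (T (?s j)) i = (\<Sum>l<?n. coord e (T (?s j)) l * coord ?s (e l) i)"
      by (rule coord_change[OF e s])
    also have "\<dots> = (\<Sum>l<?n. (\<Sum>k<?n. coord e (?s j) k * coord e (T (e k)) l) * coord ?s (e l) i)"
      using coord_apply[OF e lin, of "?s j"] by simp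
    finally show "endo_matrix ?s T $$ (i, j) = (transpose_mat ?Q * (?A * transpose_mat ?P)) $$ (i, j)"
      using ij by (simp add: endo_matrix_def base_change_def scalar_prod_def lessThan_atLeast0 mult_ac)
  qed (simp_all add: endo_matrix_def base_change_def)
  moreover have "det ?P * det ?Q = 1"
    using det_mult[OF P Q] base_change_inverse[OF e s] by simp
  ultimately show ?thesis
    using P Q A
    by (simp add: endo_det_def det_mult[of _ ?n] det_transpose[of _ ?n] mult_ac)
qed

section \<open>Scalar product spaces and algebraic curvature tensors\<close>

definition scalar_product_space :: "('v::real_vector \<Rightarrow> 'v \<Rightarrow> real) \<Rightarrow> bool" where
  "scalar_product_space g \<longleftrightarrow>
     (\<exists>B :: 'v set. finite B \<and> span B = UNIV)
     \<and> (\<forall>y. linear (\<lambda>x. g x y)) \<and> (\<forall>x. linear (\<lambda>y. g x y))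
     \<and> (\<forall>x y. g x y = g y x)
     \<and> (\<forall>x. (\<forall>y. g x y = 0) \<longrightarrow> x = 0)"

definition linear_isometries :: "('v::real_vector \<Rightarrow> 'v \<Rightarrow> real) \<Rightarrow> ('v \<Rightarrow> 'v) set" where
  "linear_isometries g = {T. linear T \<and> (\<forall>x y. g (T x) (T y) = g x y)}"

definition algebraic_curvature_tensor ::
    "('v::real_vector \<Rightarrow> 'v \<Rightarrow> 'v \<Rightarrow> 'v \<Rightarrow> real) \<Rightarrow> bool" where
  "algebraic_curvature_tensor C \<longleftrightarrow>
     (\<forall>v x y. linear (\<lambda>u. C u v x y)) \<and> (\<forall>u x y. linear (\<lambda>v. C u v x y))
     \<and> (\<forall>u v y. linear (\<lambda>x. C u v x y)) \<and> (\<forall>u v x. linear (\<lambda>y. C u v x y))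
     \<and> (\<forall>u v x y. C u v x y = - C v u x y)
     \<and> (\<forall>u v x y. C u v x y = - C u v y x)
     \<and> (\<forall>u v x y. C u v x y = C x y u v)
     \<and> (\<forall>u v x y. C u v x y + C x u v y + C v x u y = 0)"

definition pullback4 ::
    "('v \<Rightarrow> 'v) \<Rightarrow> ('v \<Rightarrow> 'v \<Rightarrow> 'v \<Rightarrow> 'v \<Rightarrow> real) \<Rightarrow> 'v \<Rightarrow> 'v \<Rightarrow> 'v \<Rightarrow> 'v \<Rightarrow> real" where
  "pullback4 \<theta> C u x y z = C (\<theta> u) (\<theta> x) (\<theta> y) (\<theta> z)"

definition even_tensor ::
    "('v \<Rightarrow> 'v) \<Rightarrow> ('v \<Rightarrow> 'v \<Rightarrow> 'v \<Rightarrow> 'v \<Rightarrow> real) \<Rightarrow> bool" where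
  "even_tensor \<theta> C \<longleftrightarrow> pullback4 \<theta> C = C"

definition odd_tensor ::
    "('v \<Rightarrow> 'v) \<Rightarrow> ('v \<Rightarrow> 'v \<Rightarrow> 'v \<Rightarrow> 'v \<Rightarrow> real) \<Rightarrow> bool" where
  "odd_tensor \<theta> C \<longleftrightarrow> pullback4 \<theta> C = (\<lambda>u x y z. - C u x y z)"

section \<open>Pontryagin forms\<close>

text \<open>The \<open>(1,3)\<close>-tensor of \<open>C\<close>; the defining vector exists uniquely (\<open>curv_op_unique\<close> below).\<close>

definition curv_op ::
    "('v::real_vector \<Rightarrow> 'v \<Rightarrow> real) \<Rightarrow> ('v \<Rightarrow> 'v \<Rightarrow> 'v \<Rightarrow> 'v \<Rightarrow> real) \<Rightarrow> 'v \<Rightarrow> 'v \<Rightarrow> 'v \<Rightarrow> 'v" where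
  "curv_op g C u v x = (THE w. \<forall>y. g w y = C u v x y)"

text \<open>The element of \<open>\<And>\<^sup>2 V\<^sup>*\<close> given by an alternating bilinear map.\<close>

definition two_form :: "('v::real_vector \<Rightarrow> 'v \<Rightarrow> real) \<Rightarrow> 'v even_form" where
  "two_form f = Even_Form (\<lambda>vs. case vs of [u, v] \<Rightarrow> f u v | _ \<Rightarrow> 0)"

definition curvature_matrix ::
    "(nat \<Rightarrow> 'v::real_vector) \<Rightarrow> ('v \<Rightarrow> 'v \<Rightarrow> real) \<Rightarrow> ('v \<Rightarrow> 'v \<Rightarrow> 'v \<Rightarrow> 'v \<Rightarrow> real)
      \<Rightarrow> 'v even_form mat" where
  "curvature_matrix e g C = mat (dim (UNIV :: 'v set)) (dim (UNIV :: 'v set))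
     (\<lambda>(i, j). two_form (\<lambda>u v. coord e (curv_op g C u v (e i)) j))"

text \<open>\<open>\<sigma>\<^sub>m(X)\<close> is the coefficient of \<open>t\<^sup>m\<close> in \<open>det(I + tX)\<close>, computed over \<open>'a[t]\<close>; since this is a
  universal integer polynomial in the entries, it makes sense over every commutative ring,
  here the ring of even forms.\<close>

definition sigma_poly :: "nat \<Rightarrow> 'a::comm_ring_1 mat \<Rightarrow> 'a" where
  "sigma_poly m X =
     coeff (det (1\<^sub>m (dim_row X) + monom 1 1 \<cdot>\<^sub>m map_mat (\<lambda>a. [:a:]) X)) m"

text \<open>The basis chosen is irrelevant, see \<open>pontryagin_form_eq\<close>.\<close>

definition pontryagin_form ::
    "('v::real_vector \<Rightarrow> 'v \<Rightarrow> real) \<Rightarrow> ('v \<Rightarrow> 'v \<Rightarrow> 'v \<Rightarrow> 'v \<Rightarrow> real) \<Rightarrow> nat \<Rightarrow> 'v even_form" where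
  "pontryagin_form g C j =
     (1 / (2 * pi) ^ (2 * j)) *\<^sub>R sigma_poly (2 * j) (curvature_matrix some_basis g C)"

definition pontryagin_monomial ::
    "('v::real_vector \<Rightarrow> 'v \<Rightarrow> real) \<Rightarrow> ('v \<Rightarrow> 'v \<Rightarrow> 'v \<Rightarrow> 'v \<Rightarrow> real) \<Rightarrow> nat list \<Rightarrow> 'v even_form" where
  "pontryagin_monomial g C \<alpha> = prod_list (map (pontryagin_form g C) \<alpha>)"

subsection \<open>Well-definedness\<close>

lemma scalar_product_spaceD:
  fixes g :: "'v::real_vector \<Rightarrow> 'v \<Rightarrow> real"
  assumes "scalar_product_space g"
  shows "\<exists>B :: 'v set. finite B \<and> span B = UNIV" "linear (\<lambda>x. g x y)" "linear (\<lambda>y. g x y)"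
    "g x y = g y x" "(\<And>y. g x y = 0) \<Longrightarrow> x = 0"
proof -
  note g = assms[unfolded scalar_product_space_def]
  show "\<exists>B :: 'v set. finite B \<and> span B = UNIV" by (rule g[THEN conjunct1])
  show "linear (\<lambda>x. g x y)" by (rule g[THEN conjunct2, THEN conjunct1, rule_format])
  show "linear (\<lambda>y. g x y)"
    by (rule g[THEN conjunct2, THEN conjunct2, THEN conjunct1, rule_format])
  show "g x y = g y x"
    by (rule g[THEN conjunct2, THEN conjunct2, THEN conjunct2, THEN conjunct1, rule_format])
  show "x = 0" if "\<And>y. g x y = 0"
    using that
    by (rule g[THEN conjunct2, THEN conjunct2, THEN conjunct2, THEN conjunct2, rule_format])
qed

lemma scalar_product_represents:
  assumes g: "scalar_product_space (g :: 'v::real_vector \<Rightarrow> 'v \<Rightarrow> real)" and \<phi>: "linear \<phi>"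
  shows "\<exists>!w. \<forall>y. g w y = \<phi> y"
proof -
  let ?n = "dim (UNIV :: 'v set)"
  note gl = scalar_product_spaceD(2)[OF g] and gr = scalar_product_spaceD(3)[OF g]
    and nd = scalar_product_spaceD(5)[OF g]
  obtain e :: "nat \<Rightarrow> 'v" where e: "is_basis e"
    using scalar_product_spaceD(1)[OF g] is_basis_exists by blast
  let ?B = "e ` {..<?n}"
  define L where "L x = (\<Sum>i<?n. g x (e i) *\<^sub>R e i)" for x
  have L: "linear L"
    by (rule linearI)
      (simp_all add: L_def linear_add[OF gl] linear_scale[OF gl] scaleR_left_distrib sum.distrib
        scaleR_sum_right)
  have cL: "coord e (L x) i = g x (e i)" if "i < ?n" for x i
  proof -
    have "coord e (L x) i = (\<Sum>l<?n. g x (e l) * coord e (e l) i)"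
      by (simp add: L_def linear_sum[OF linear_coord[OF e]] linear_scale[OF linear_coord[OF e]])
    also have "\<dots> = (\<Sum>l<?n. if l = i then g x (e l) else 0)"
      using that by (intro sum.cong) (auto simp: coord_basis[OF e])
    also have "\<dots> = g x (e i)" using that by simp
    finally show ?thesis .
  qed
  have ext0: "\<psi> = \<psi>'" if "linear \<psi>" "linear \<psi>'" "\<And>i. i < ?n \<Longrightarrow> \<psi> (e i) = \<psi>' (e i)"
    for \<psi> \<psi>' :: "'v \<Rightarrow> real"
  proof (rule ext)
    fix v
    show "\<psi> v = \<psi>' v"
      unfolding coord_apply[OF e that(1), of v] coord_apply[OF e that(2), of v]
      using that(3) by (intro sum.cong) auto
  qed
  have inj: "inj L"
  proof (rule linear_inj_iff_eq_0[OF L, THEN iffD2], intro allI impI)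
    fix x assume "L x = 0"
    then have "g x (e i) = 0" if "i < ?n" for i
      using cL[OF that, of x] linear_0[OF linear_coord[OF e]] by simp
    then have "(\<lambda>y. g x y) = (\<lambda>_. 0)"
      by (intro ext0 gr) (auto simp: linear_iff)
    then show "x = 0" by (intro nd) meson
  qed
  have "surj L"
  proof (rule ccontr)
    assume "\<not> surj L"
    then obtain b where b: "b \<notin> range L" by auto
    have "span (L ` ?B) = range L"
      using linear_span_image[OF L, of ?B] is_basisD(3)[OF e] by simp
    then have nb: "b \<notin> span (L ` ?B)" using b by simp
    have "independent (L ` ?B)"
      using linear_independent_injective_image[OF L is_basisD(2)[OF e]] inj
      by (auto intro: inj_on_subset)
    then have "independent (insert b (L ` ?B))"
      using nb by (simp add: independent_insertI)
    then have "card (insert b (L ` ?B)) \<le> card ?B"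
      using independent_span_bound[of ?B "insert b (L ` ?B)"] is_basisD(3)[OF e] by simp
    moreover have "b \<notin> L ` ?B" using b by auto
    moreover have "card (L ` ?B) = card ?B"
      using inj by (intro card_image) (auto intro: inj_on_subset)
    ultimately show False by simp
  qed
  then obtain w where w: "L w = (\<Sum>i<?n. \<phi> (e i) *\<^sub>R e i)" by (metis surjD)
  have "g w (e i) = \<phi> (e i)" if "i < ?n" for i
  proof -
    have "g w (e i) = (\<Sum>l<?n. \<phi> (e l) * coord e (e l) i)"
      unfolding cL[OF that, symmetric] w
      by (simp add: linear_sum[OF linear_coord[OF e]] linear_scale[OF linear_coord[OF e]])
    also have "\<dots> = (\<Sum>l<?n. if l = i then \<phi> (e l) else 0)"
      using that by (intro sum.cong) (auto simp: coord_basis[OF e])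
    also have "\<dots> = \<phi> (e i)" using that by simp
    finally show ?thesis .
  qed
  then have "(\<lambda>y. g w y) = \<phi>" by (intro ext0 gr \<phi>)
  then have ex: "\<forall>y. g w y = \<phi> y" by meson
  show ?thesis
  proof (rule ex1I[of _ w])
    show "\<forall>y. g w y = \<phi> y" by (rule ex)
  next
    fix w' assume w': "\<forall>y. g w' y = \<phi> y"
    have "w' - w = 0"
      by (rule nd) (simp add: linear_diff[OF gl] ex w')
    then show "w' = w" by simp
  qed
qed

lemma algebraic_curvature_tensorD:
  assumes "algebraic_curvature_tensor C"
  shows "linear (\<lambda>u. C u v x y)" "linear (\<lambda>v. C u v x y)"
    "linear (\<lambda>x. C u v x y)" "linear (\<lambda>y. C u v x y)" "C u v x y = - C v u x y"
proof -
  note C = assms[unfolded algebraic_curvature_tensor_def]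
  show "linear (\<lambda>u. C u v x y)" by (rule C[THEN conjunct1, rule_format])
  show "linear (\<lambda>v. C u v x y)" by (rule C[THEN conjunct2, THEN conjunct1, rule_format])
  show "linear (\<lambda>x. C u v x y)"
    by (rule C[THEN conjunct2, THEN conjunct2, THEN conjunct1, rule_format])
  show "linear (\<lambda>y. C u v x y)"
    by (rule C[THEN conjunct2, THEN conjunct2, THEN conjunct2, THEN conjunct1, rule_format])
  show "C u v x y = - C v u x y"
    by (rule C[THEN conjunct2, THEN conjunct2, THEN conjunct2, THEN conjunct2, THEN conjunct1, rule_format])
qed

lemma curv_op_unique:
  assumes "scalar_product_space g" "algebraic_curvature_tensor C"
  shows "\<exists>!w. \<forall>y. g w y = C u v x y"
  by (rule scalar_product_represents[OF assms(1) algebraic_curvature_tensorD(4)[OF assms(2)]])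

lemma curv_op:
  assumes "scalar_product_space g" "algebraic_curvature_tensor C"
  shows "g (curv_op g C u v x) y = C u v x y"
  unfolding curv_op_def using theI'[OF curv_op_unique[OF assms], of u v x] by blast

lemma curv_op_eqI:
  assumes "scalar_product_space g" "algebraic_curvature_tensor C" "\<And>y. g w y = C u v x y"
  shows "curv_op g C u v x = w"
  unfolding curv_op_def using curv_op_unique[OF assms(1,2), of u v x] assms(3)
  by (intro the1_equality) auto

lemma linear_curv_op:
  assumes g: "scalar_product_space g" and C: "algebraic_curvature_tensor C"
  shows "linear (\<lambda>u. curv_op g C u v x)" "linear (\<lambda>v. curv_op g C u v x)"
    "linear (\<lambda>x. curv_op g C u v x)" "curv_op g C u u x = 0"
proof -
  note gl = scalar_product_spaceD(2)[OF g]
  note c1 = algebraic_curvature_tensorD(1)[OF C]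
  note c2 = algebraic_curvature_tensorD(2)[OF C]
  note c3 = algebraic_curvature_tensorD(3)[OF C]
  note sk = algebraic_curvature_tensorD(5)[OF C]
  note s = linear_add[OF gl] linear_scale[OF gl] curv_op[OF g C]
  show "linear (\<lambda>u. curv_op g C u v x)"
    by (intro linearI curv_op_eqI[OF g C]) (simp_all add: s linear_add[OF c1] linear_scale[OF c1])
  show "linear (\<lambda>v. curv_op g C u v x)"
    by (intro linearI curv_op_eqI[OF g C]) (simp_all add: s linear_add[OF c2] linear_scale[OF c2])
  show "linear (\<lambda>x. curv_op g C u v x)"
    by (intro linearI curv_op_eqI[OF g C]) (simp_all add: s linear_add[OF c3] linear_scale[OF c3])
  show "curv_op g C u u x = 0"
    using sk[of u u x] by (intro curv_op_eqI[OF g C]) (simp add: linear_0[OF gl])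
qed

definition alternating_bilinear :: "('v::real_vector \<Rightarrow> 'v \<Rightarrow> real) \<Rightarrow> bool" where
  "alternating_bilinear f \<longleftrightarrow>
     (\<forall>v. linear (\<lambda>u. f u v)) \<and> (\<forall>u. linear (\<lambda>v. f u v)) \<and> (\<forall>u. f u u = 0)"

lemma eval_two_form:
  assumes "alternating_bilinear f"
  shows "eval_form (two_form f) vs = (case vs of [u, v] \<Rightarrow> f u v | _ \<Rightarrow> 0)"
proof -
  let ?h = "\<lambda>vs. case vs of [u, v] \<Rightarrow> f u v | _ \<Rightarrow> 0"
  have z: "?h zs = 0" if "length zs \<noteq> 2" for zs
    using that by (auto split: list.splits)
  have "linear (\<lambda>v. ?h (xs @ v # ys))" for xs ys
  proof -
    consider "length xs + length ys \<noteq> 1" | b where "xs = []" "ys = [b]" | a where "xs = [a]" "ys = []"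
      by (cases xs; cases ys) auto
    then show ?thesis
    proof cases
      case 1
      then have "?h (xs @ v # ys) = 0" for v
        by (intro z) simp
      then show ?thesis by (simp add: linear_iff)
    next
      case 2
      then show ?thesis using assms by (simp add: alternating_bilinear_def)
    next
      case 3
      then show ?thesis using assms by (simp add: alternating_bilinear_def)
    qed
  qed
  moreover have "?h vs = 0" if "\<not> distinct vs" for vs
    using assms that by (auto simp: alternating_bilinear_def split: list.splits)
  moreover have "?h vs = 0" if "odd (length vs)" for vs
    using that by (auto split: list.splits)
  ultimately show ?thesis
    unfolding two_form_def
    by (subst Even_Form_inverse) (simp_all add: alternating_form_def multilinear_form_def)
qed

lemma alternating_bilinear_curvature:
  assumes "is_basis e" "scalar_product_space g" "algebraic_curvature_tensor C"
  shows "alternating_bilinear (\<lambda>u v. coord e (curv_op g C u v x) j)"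
  unfolding alternating_bilinear_def
  using linear_compose[OF linear_curv_op(1)[OF assms(2,3)] linear_coord[OF assms(1), of j]]
    linear_compose[OF linear_curv_op(2)[OF assms(2,3)] linear_coord[OF assms(1), of j]]
    linear_curv_op(4)[OF assms(2,3)] linear_0[OF linear_coord[OF assms(1)]]
  by (simp add: o_def)

lemma eval_form_sum: "eval_form (sum F A) vs = (\<Sum>x\<in>A. eval_form (F x) vs)"
  by (induction A rule: infinite_finite_induct) (simp_all add: eval_form_zero eval_form_add)

lemma alternating_bilinear_sum:
  assumes "\<And>k. k \<in> A \<Longrightarrow> alternating_bilinear (f k)"
  shows "alternating_bilinear (\<lambda>u v. \<Sum>k\<in>A. c k * f k u v)"
  using assms unfolding alternating_bilinear_def
  by (auto intro!: linear_compose_sum linear_scaled_add)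

lemma two_form_sum:
  assumes "\<And>k. k \<in> A \<Longrightarrow> alternating_bilinear (f k)"
  shows "two_form (\<lambda>u v. \<Sum>k\<in>A. c k * f k u v) = (\<Sum>k\<in>A. c k *\<^sub>R two_form (f k))"
proof (rule even_form_eqI)
  fix vs
  show "eval_form (two_form (\<lambda>u v. \<Sum>k\<in>A. c k * f k u v)) vs
      = eval_form (\<Sum>k\<in>A. c k *\<^sub>R two_form (f k)) vs"
    using assms
    by (auto simp: eval_two_form alternating_bilinear_sum eval_form_sum eval_form_scaleR
        split: list.splits)
qed

lemma sigma_poly_conj:
  fixes X :: "'a::comm_ring_1 mat"
  assumes X: "X \<in> carrier_mat n n" and P: "P \<in> carrier_mat n n" and Q: "Q \<in> carrier_mat n n"
    and PQ: "P * Q = 1\<^sub>m n" and QP: "Q * P = 1\<^sub>m n"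
  shows "sigma_poly m (P * X * Q) = sigma_poly m X"
proof -
  interpret c: comm_ring_hom "\<lambda>a :: 'a. [:a:]"
    by unfold_locales (simp_all add: one_pCons)
  let ?c = "map_mat (\<lambda>a :: 'a. [:a:])"
  let ?t = "monom 1 1 :: 'a poly"
  have cX: "?c X \<in> carrier_mat n n" and cP: "?c P \<in> carrier_mat n n" and cQ: "?c Q \<in> carrier_mat n n"
    using X P Q by auto
  have cPQ: "?c P * ?c Q = 1\<^sub>m n" and cQP: "?c Q * ?c P = 1\<^sub>m n"
    using c.mat_hom_mult[OF P Q] c.mat_hom_mult[OF Q P] PQ QP by (simp_all add: c.mat_hom_one)
  have "?c (P * X * Q) = ?c P * ?c X * ?c Q"
    using c.mat_hom_mult[OF mult_carrier_mat[OF P X] Q] c.mat_hom_mult[OF P X] by simp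
  then have "1\<^sub>m n + ?t \<cdot>\<^sub>m ?c (P * X * Q) = ?c P * ?c Q + ?t \<cdot>\<^sub>m (?c P * ?c X * ?c Q)"
    by (simp add: cPQ)
  also have "?t \<cdot>\<^sub>m (?c P * ?c X * ?c Q) = ?c P * (?t \<cdot>\<^sub>m ?c X) * ?c Q"
    by (simp only: mult_smult_distrib[OF cP cX] mult_smult_assoc_mat[OF mult_carrier_mat[OF cP cX] cQ])
  also have "?c P * ?c Q = ?c P * 1\<^sub>m n * ?c Q"
    using cP by simp
  also have "?c P * 1\<^sub>m n * ?c Q + ?c P * (?t \<cdot>\<^sub>m ?c X) * ?c Q
      = (?c P * 1\<^sub>m n + ?c P * (?t \<cdot>\<^sub>m ?c X)) * ?c Q"
    by (rule add_mult_distrib_mat[symmetric]) (use cX cP cQ in auto)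
  also have "?c P * 1\<^sub>m n + ?c P * (?t \<cdot>\<^sub>m ?c X) = ?c P * (1\<^sub>m n + ?t \<cdot>\<^sub>m ?c X)"
    by (rule mult_add_distrib_mat[symmetric]) (use cX cP in auto)
  finally have "similar_mat (1\<^sub>m n + ?t \<cdot>\<^sub>m ?c (P * X * Q)) (1\<^sub>m n + ?t \<cdot>\<^sub>m ?c X)"
    by (intro similar_matI[OF _ cPQ cQP]) (use cX cP cQ X P Q in auto)
  from det_similar[OF this] show ?thesis
    using X P by (simp add: sigma_poly_def)
qed

lemma pontryagin_form_eq:
  fixes e :: "nat \<Rightarrow> 'v::real_vector"
  assumes e: "is_basis e" and g: "scalar_product_space g" and C: "algebraic_curvature_tensor C"
  shows "pontryagin_form g C j =
    (1 / (2 * pi) ^ (2 * j)) *\<^sub>R sigma_poly (2 * j) (curvature_matrix e g C)"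
proof -
  let ?n = "dim (UNIV :: 'v set)"
  let ?s = "some_basis :: nat \<Rightarrow> 'v"
  have s: "is_basis ?s"
    unfolding some_basis_def by (rule someI[of is_basis, OF e])
  let ?r = "map_mat (of_real :: real \<Rightarrow> 'v even_form)"
  let ?P = "?r (base_change e ?s)" and ?Q = "?r (base_change ?s e)"
  let ?X = "curvature_matrix e g C"
  have P: "?P \<in> carrier_mat ?n ?n" and Q: "?Q \<in> carrier_mat ?n ?n"
    using base_change_carrier by auto
  have X: "?X \<in> carrier_mat ?n ?n" by (simp add: curvature_matrix_def)
  have PQ: "?P * ?Q = 1\<^sub>m ?n" and QP: "?Q * ?P = 1\<^sub>m ?n"
    unfolding of_real_hom.mat_hom_mult[OF base_change_carrier base_change_carrier, symmetric]
      base_change_inverse[OF e s] base_change_inverse[OF s e] of_real_hom.mat_hom_one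
    by (rule refl)+
  have "curvature_matrix ?s g C = ?P * ?X * ?Q"
  proof (rule eq_matI)
    fix i j assume "i < dim_row (?P * ?X * ?Q)" "j < dim_col (?P * ?X * ?Q)"
    then have ij: "i < ?n" "j < ?n" by (auto simp: base_change_def)
    let ?f = "\<lambda>k l u v. coord e (curv_op g C u v (e k)) l"
    have ab: "alternating_bilinear (?f k l)" for k l
      by (rule alternating_bilinear_curvature[OF e g C])
    have lin: "linear (\<lambda>x. coord e (curv_op g C u v x) l)" for u v l
      using linear_compose[OF linear_curv_op(3)[OF g C] linear_coord[OF e, of l]]
      by (simp add: o_def)
    have "coord ?s (curv_op g C u v (?s i)) j
        = (\<Sum>l<?n. coord ?s (e l) j * (\<Sum>k<?n. coord e (?s i) k * ?f k l u v))" for u v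
      unfolding coord_change[OF e s, of "curv_op g C u v (?s i)"]
      using coord_apply[OF e lin, where v = "?s i"] by (simp add: mult.commute)
    then have "two_form (\<lambda>u v. coord ?s (curv_op g C u v (?s i)) j)
        = (\<Sum>l<?n. coord ?s (e l) j *\<^sub>R (\<Sum>k<?n. coord e (?s i) k *\<^sub>R two_form (?f k l)))"
      by (simp add: two_form_sum ab alternating_bilinear_sum)
    then show "curvature_matrix ?s g C $$ (i, j) = (?P * ?X * ?Q) $$ (i, j)"
      using ij
      by (simp add: curvature_matrix_def base_change_def scalar_prod_def lessThan_atLeast0
          scaleR_conv_of_real mult.commute)
  qed (simp_all add: curvature_matrix_def base_change_def)
  then show ?thesis
    by (simp add: pontryagin_form_def sigma_poly_conj[OF X P Q PQ QP])
qed

end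

theory Submission
  imports Defs "Jordan_Normal_Form.Char_Poly"
begin

text \<open>
  An isometry \<open>\<theta>\<close> with \<open>\<theta>\<^sup>*C = c C\<close>, \<open>c = \<plusminus>1\<close>, carries the curvature endomorphisms to \<open>c\<close> times
  themselves, so that \<open>\<theta>\<^sup>*\<Omega>\<close>, with \<open>\<Omega>\<close> taken in the basis \<open>\<theta> \<circ> e\<close>, is \<open>c\<close> times the curvature matrix in
  the basis \<open>e\<close>.  Since \<open>\<sigma>\<^bsub>2j\<^esub>\<close> is homogeneous of even degree and independent of the basis,
  \<open>\<theta>\<^sup>*\<close> fixes every Pontryagin form and hence every monomial in them.  On forms of top degree,
  however, \<open>\<theta>\<^sup>*\<close> is multiplication by \<open>det \<theta> = - 1\<close>.
\<close>

section \<open>Forms of top degree\<close>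

text \<open>Multilinearity is formulated by splitting argument lists. This converts it to families
  \<open>w\<close> indexed by slot numbers, which suit permutations and sums over slots.\<close>

lemma linear_map_fun_upd:
  assumes f: "multilinear_form f" and a: "a < n"
  shows "linear (\<lambda>u. f (map (w(a := u)) [0..<n]))"
proof -
  have "[0..<n] = [0..<a] @ a # [Suc a..<n]"
    using a upt_add_eq_append[of 0 a "n - a"] by (simp add: upt_conv_Cons)
  then have "map (w(a := u)) [0..<n] = map w [0..<a] @ u # map w [Suc a..<n]" for u
    by simp
  then show ?thesis using multilinear_formD[OF f] by simp
qed

lemma alternating_form_map_eq_0:
  assumes "alternating_form f" "\<not> inj_on w {..<n}"
  shows "f (map w [0..<n]) = 0"
  using assms by (simp add: alternating_form_def distinct_map lessThan_atLeast0)

text \<open>Polarization: with the other slots frozen, \<open>h\<close> is bilinear and vanishes on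
  the diagonal, so expanding it at \<open>w a + w b\<close> leaves only the two mixed terms.\<close>

lemma alternating_form_transpose:
  assumes f: "alternating_form f" and ab: "a < n" "b < n" "a \<noteq> b"
  shows "f (map (w \<circ> Transposition.transpose a b) [0..<n]) = - f (map w [0..<n])"
proof -
  define h where "h u v = f (map (w(a := u, b := v)) [0..<n])" for u v
  have m: "multilinear_form f" using f by (simp add: alternating_form_def)
  have l2: "linear (h u)" for u
    unfolding h_def by (rule linear_map_fun_upd[OF m ab(2)])
  have "linear (\<lambda>u. h u v)" for v
    using linear_map_fun_upd[OF m ab(1), of "w(b := v)"] ab(3)
    by (simp add: h_def fun_upd_twist)
  note l1 = this
  have z: "h u u = 0" for u
  proof -
    have "\<not> inj_on (w(a := u, b := u)) {..<n}"
      using ab by (auto simp: inj_on_def)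
    then show ?thesis unfolding h_def by (rule alternating_form_map_eq_0[OF f])
  qed
  have "0 = h (w a + w b) (w a + w b)" by (simp add: z)
  also have "\<dots> = h (w a) (w b) + h (w b) (w a)"
    unfolding linear_add[OF l1] linear_add[OF l2] by (simp add: z)
  finally have "h (w b) (w a) = - h (w a) (w b)" by simp
  moreover have "w \<circ> Transposition.transpose a b = w(a := w b, b := w a)"
    using ab(3) by (auto simp: Transposition.transpose_def)
  ultimately show ?thesis by (simp add: h_def)
qed

lemma alternating_form_permutes:
  assumes f: "alternating_form f" and p: "p permutes {0..<n}"
  shows "f (map (w \<circ> p) [0..<n]) = of_int (sign p) * f (map w [0..<n])"
  using p finite_atLeastLessThan
proof (induction arbitrary: w rule: permutes_induct)
  case id
  then show ?case by simp
next
  case (swap a b p)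
  have "permutation p"
    using swap.hyps unfolding permutation_permutes by blast
  then have "sign (Transposition.transpose a b \<circ> p) = - sign p"
    using \<open>a \<noteq> b\<close> by (simp add: sign_compose permutation_swap_id sign_swap_id)
  \<comment> \<open>The transposition is absorbed into the family, which is why the induction
    generalises \<open>w\<close>.\<close>
  moreover have "f (map (w \<circ> (Transposition.transpose a b \<circ> p)) [0..<n])
      = of_int (sign p) * f (map (w \<circ> Transposition.transpose a b) [0..<n])"
    using swap.IH[of "w \<circ> Transposition.transpose a b"] by (simp only: o_assoc)
  moreover have "f (map (w \<circ> Transposition.transpose a b) [0..<n]) = - f (map w [0..<n])"
    using swap.hyps by (intro alternating_form_transpose[OF f]) auto
  ultimately show ?case by (simp only: of_int_minus mult_minus_left mult_minus_right)
qed

text \<open>The maps are the identity off \<open>S\<close>, so that \<open>extended_funs {..<n} n\<close> contains the permutations of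
  \<open>{..<n}\<close> in the sense of \<open>permutes\<close>.\<close>

definition extended_funs :: "nat set \<Rightarrow> nat \<Rightarrow> (nat \<Rightarrow> nat) set" where
  "extended_funs S n = {\<phi>. (\<forall>i\<in>S. \<phi> i < n) \<and> (\<forall>i. i \<notin> S \<longrightarrow> \<phi> i = i)}"

text \<open>A map on \<open>insert a S\<close> is a free choice of its value at \<open>a\<close>
  together with a map on \<open>S\<close>. The fixed default off the domain makes the latter
  unique.\<close>

lemma extended_funs_insert:
  assumes "a \<notin> S"
  shows "bij_betw (\<lambda>(j, \<phi>). \<phi>(a := j)) ({..<n} \<times> extended_funs S n) (extended_funs (insert a S) n)"
  unfolding bij_betw_def
proof
  show "inj_on (\<lambda>(j, \<phi>). \<phi>(a := j)) ({..<n} \<times> extended_funs S n)"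
  proof (rule inj_onI, clarify)
    fix i j :: nat and \<phi> \<psi>
    assume \<phi>: "\<phi> \<in> extended_funs S n" and \<psi>: "\<psi> \<in> extended_funs S n"
      and eq: "\<phi>(a := i) = \<psi>(a := j)"
    have "\<phi> x = \<psi> x" for x
      using \<phi> \<psi> assms fun_cong[OF eq, of x] by (cases "x = a") (auto simp: extended_funs_def)
    then show "i = j \<and> \<phi> = \<psi>"
      using fun_cong[OF eq, of a] by auto
  qed
next
  show "(\<lambda>(j, \<phi>). \<phi>(a := j)) ` ({..<n} \<times> extended_funs S n) = extended_funs (insert a S) n"
  proof
    show "extended_funs (insert a S) n \<subseteq> (\<lambda>(j, \<phi>). \<phi>(a := j)) ` ({..<n} \<times> extended_funs S n)"
    proof
      fix \<phi> assume "\<phi> \<in> extended_funs (insert a S) n"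
      \<comment> \<open>Resetting the value at \<open>a\<close> to the default \<open>a\<close>
        gives the preimage in \<open>extended_funs S n\<close>.\<close>
      then show "\<phi> \<in> (\<lambda>(j, \<phi>). \<phi>(a := j)) ` ({..<n} \<times> extended_funs S n)"
        using assms
        by (intro image_eqI[of _ _ "(\<phi> a, \<phi>(a := a))"]) (auto simp: extended_funs_def)
    qed
  qed (use assms in \<open>auto simp: extended_funs_def\<close>)
qed

lemma finite_extended_funs: "finite S \<Longrightarrow> finite (extended_funs S n)"
proof (induction S rule: finite_induct)
  case empty
  have "extended_funs {} n = {id}" by (auto simp: extended_funs_def)
  then show ?case by simp
next
  case (insert a S)
  then show ?case using bij_betw_finite[OF extended_funs_insert] by blast
qed

text \<open>The slots in \<open>S\<close> are expanded one after another while the others hold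
  arbitrary vectors \<open>w\<close>. Distributing the sums leaves one term for each choice function
  \<open>\<phi>\<close>.\<close>

lemma multilinear_form_expand:
  fixes e w :: "nat \<Rightarrow> 'v::real_vector"
  assumes f: "multilinear_form f" and S: "finite S" "S \<subseteq> {..<n}"
  shows "f (map (\<lambda>i. if i \<in> S then \<Sum>j<d. A i j *\<^sub>R e j else w i) [0..<n])
    = (\<Sum>\<phi>\<in>extended_funs S d. (\<Prod>i\<in>S. A i (\<phi> i)) *
        f (map (\<lambda>i. if i \<in> S then e (\<phi> i) else w i) [0..<n]))"
  using S
proof (induction S arbitrary: w rule: finite_induct)
  case empty
  have "extended_funs {} d = {id}" by (auto simp: extended_funs_def)
  then show ?case by simp
next
  case (insert a S)
  have a: "a < n" and aS: "a \<notin> S" using insert by auto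
  let ?W = "\<lambda>i. if i \<in> S then \<Sum>j<d. A i j *\<^sub>R e j else w i"
  have lin: "linear (\<lambda>u. f (map (?W(a := u)) [0..<n]))"
    by (rule linear_map_fun_upd[OF f a])
  have "f (map (\<lambda>i. if i \<in> insert a S then \<Sum>j<d. A i j *\<^sub>R e j else w i) [0..<n])
      = f (map (?W(a := \<Sum>j<d. A a j *\<^sub>R e j)) [0..<n])"
    by (intro arg_cong[of _ _ f] map_cong) auto
  also have "\<dots> = (\<Sum>j<d. A a j * f (map (?W(a := e j)) [0..<n]))"
    unfolding linear_sum[OF lin] linear_scale[OF lin] by simp
  also have "\<dots> = (\<Sum>j<d. A a j * f (map (\<lambda>i. if i \<in> S then \<Sum>j<d. A i j *\<^sub>R e j
      else (w(a := e j)) i) [0..<n]))"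
    by (intro sum.cong arg_cong[of _ _ "\<lambda>x. _ * f x"] map_cong) (use aS in auto)
  also have "\<dots> = (\<Sum>j<d. \<Sum>\<phi>\<in>extended_funs S d. A a j * ((\<Prod>i\<in>S. A i (\<phi> i)) *
        f (map (\<lambda>i. if i \<in> S then e (\<phi> i) else (w(a := e j)) i) [0..<n])))"
    using insert by (simp only: insert.IH sum_distrib_left insert_subset)
  also have "\<dots> = (\<Sum>(j, \<phi>)\<in>{..<d} \<times> extended_funs S d.
      (\<Prod>i\<in>insert a S. A i ((\<phi>(a := j)) i)) *
        f (map (\<lambda>i. if i \<in> insert a S then e ((\<phi>(a := j)) i) else w i) [0..<n]))"
    unfolding sum.cartesian_product
  proof (intro sum.cong refl, clarify)
    fix j \<phi>
    have 1: "(\<Prod>i\<in>S. A i ((\<phi>(a := j)) i)) = (\<Prod>i\<in>S. A i (\<phi> i))"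
      by (intro prod.cong) (use aS in auto)
    have 2: "map (\<lambda>i. if i \<in> insert a S then e ((\<phi>(a := j)) i) else w i) [0..<n]
        = map (\<lambda>i. if i \<in> S then e (\<phi> i) else (w(a := e j)) i) [0..<n]"
      by (intro map_cong) (use aS in auto)
    show "A a j * ((\<Prod>i\<in>S. A i (\<phi> i)) *
        f (map (\<lambda>i. if i \<in> S then e (\<phi> i) else (w(a := e j)) i) [0..<n]))
      = (\<Prod>i\<in>insert a S. A i ((\<phi>(a := j)) i)) *
        f (map (\<lambda>i. if i \<in> insert a S then e ((\<phi>(a := j)) i) else w i) [0..<n])"
      unfolding 1 2 prod.insert[OF insert(1) aS] by simp
  qed
  also have "\<dots> = (\<Sum>\<phi>\<in>extended_funs (insert a S) d. (\<Prod>i\<in>insert a S. A i (\<phi> i)) *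
        f (map (\<lambda>i. if i \<in> insert a S then e (\<phi> i) else w i) [0..<n]))"
    using sum.reindex_bij_betw[OF extended_funs_insert[OF aS], of
        "\<lambda>\<phi>. (\<Prod>i\<in>insert a S. A i (\<phi> i)) *
        f (map (\<lambda>i. if i \<in> insert a S then e (\<phi> i) else w i) [0..<n])" d]
    by (simp only: case_prod_unfold)
  finally show ?case .
qed

text \<open>Expanding every slot gives a sum over all choice functions. Those that are not
  permutations repeat an argument and vanish; the permutations contribute their sign, which is the
  Leibniz formula.\<close>

lemma alternating_form_det:
  fixes e :: "nat \<Rightarrow> 'v::real_vector" and f :: "'v list \<Rightarrow> real"
  assumes f: "alternating_form f"
  shows "f (map (\<lambda>i. \<Sum>j<n. A i j *\<^sub>R e j) [0..<n])
    = det (mat n n (\<lambda>(i, j). A i j)) * f (map e [0..<n])"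
proof -
  let ?E = "extended_funs {..<n} n" and ?P = "{p. p permutes {0..<n}}"
  let ?t = "\<lambda>\<phi>. (\<Prod>i<n. A i (\<phi> i)) * f (map (e \<circ> \<phi>) [0..<n])"
  have m: "multilinear_form f" using f by (simp add: alternating_form_def)
  have "f (map (\<lambda>i. \<Sum>j<n. A i j *\<^sub>R e j) [0..<n])
      = f (map (\<lambda>i. if i \<in> {..<n} then \<Sum>j<n. A i j *\<^sub>R e j else 0) [0..<n])"
    by (intro arg_cong[of _ _ f] map_cong) auto
  also have "\<dots> = (\<Sum>\<phi>\<in>?E. (\<Prod>i<n. A i (\<phi> i)) *
      f (map (\<lambda>i. if i \<in> {..<n} then e (\<phi> i) else 0) [0..<n]))"
    by (rule multilinear_form_expand[OF m]) auto
  also have "\<dots> = (\<Sum>\<phi>\<in>?E. ?t \<phi>)"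
    by (intro sum.cong arg_cong[of _ _ "\<lambda>x. _ * f x"] map_cong) auto
  also have "\<dots> = (\<Sum>p\<in>?P. ?t p)"
  proof (rule sum.mono_neutral_right)
    show "finite ?E" by (simp add: finite_extended_funs)
    show "?P \<subseteq> ?E"
      by (auto simp: extended_funs_def permutes_def dest: permutes_in_image[of _ "{0..<n}"])
    show "\<forall>\<phi>\<in>?E - ?P. ?t \<phi> = 0"
    proof
      fix \<phi> assume \<phi>: "\<phi> \<in> ?E - ?P"
      \<comment> \<open>An injective self-map of a finite set is bijective, so a non-permutation in
        \<open>?E\<close> must repeat a value.\<close>
      have "\<not> inj_on \<phi> {..<n}"
      proof
        assume inj: "inj_on \<phi> {..<n}"
        have "\<phi> ` {..<n} \<subseteq> {..<n}" using \<phi> by (auto simp: extended_funs_def)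
        then have "bij_betw \<phi> {..<n} {..<n}"
          using inj endo_inj_surj[of "{..<n}" \<phi>] by (simp add: bij_betw_def)
        then have "\<phi> permutes {..<n}"
          by (rule bij_imp_permutes) (use \<phi> in \<open>auto simp: extended_funs_def\<close>)
        then show False using \<phi> by (simp add: lessThan_atLeast0)
      qed
      then have "\<not> inj_on (e \<circ> \<phi>) {..<n}" by (auto dest: inj_on_imageI2)
      then show "?t \<phi> = 0" using alternating_form_map_eq_0[OF f] by simp
    qed
  qed
  also have "\<dots> = (\<Sum>p\<in>?P. of_int (sign p) * (\<Prod>i<n. A i (p i)) * f (map e [0..<n]))"
    by (intro sum.cong) (simp_all add: alternating_form_permutes[OF f])
  also have "\<dots> = det (mat n n (\<lambda>(i, j). A i j)) * f (map e [0..<n])"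
    unfolding det_def'[OF mat_carrier] sum_distrib_right
  proof (intro sum.cong refl)
    fix p assume "p \<in> ?P"
    then have "p i < n" if "i < n" for i
      using permutes_in_image[of p "{0..<n}" i] that by simp
    then have "(\<Prod>i<n. A i (p i)) = (\<Prod>i = 0..<n. mat n n (\<lambda>(i, j). A i j) $$ (i, p i))"
      by (intro prod.cong) auto
    then show "of_int (sign p) * (\<Prod>i<n. A i (p i)) * f (map e [0..<n])
      = of_int (sign p) * (\<Prod>i = 0..<n. mat n n (\<lambda>(i, j). A i j) $$ (i, p i)) * f (map e [0..<n])"
      by simp
  qed
  finally show ?thesis .
qed

text \<open>Invariance together with determinant \<open>- 1\<close> gives
  \<open>f(e) = - f(e)\<close> on the basis, and the value on any \<open>dim V\<close> vectors is a
  multiple of \<open>f(e)\<close>.\<close>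

lemma alternating_form_top_eq_0:
  fixes e :: "nat \<Rightarrow> 'v::real_vector" and f :: "'v list \<Rightarrow> real"
  assumes f: "alternating_form f" and e: "is_basis e" and T: "linear T" and det: "endo_det T = - 1"
    and inv: "\<And>vs. f (map T vs) = f vs" and vs: "length vs = dim (UNIV :: 'v set)"
  shows "f vs = 0"
proof -
  let ?n = "dim (UNIV :: 'v set)"
  have "f (map e [0..<?n]) = f (map (\<lambda>i. T (e i)) [0..<?n])"
    using inv[of "map e [0..<?n]"] by (simp add: comp_def)
  also have "map (\<lambda>i. T (e i)) [0..<?n] = map (\<lambda>i. \<Sum>j<?n. coord e (T (e i)) j *\<^sub>R e j) [0..<?n]"
    by (intro map_cong refl coord_expand[OF e])
  also have "f \<dots> = det (mat ?n ?n (\<lambda>(i, j). coord e (T (e i)) j)) * f (map e [0..<?n])"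
    by (rule alternating_form_det[OF f])
  \<comment> \<open>The expansion puts the coordinates of \<open>T (e i)\<close> in row
    \<open>i\<close>, whereas \<open>endo_matrix\<close> has them as columns.\<close>
  also have "mat ?n ?n (\<lambda>(i, j). coord e (T (e i)) j) = transpose_mat (endo_matrix e T)"
    by (rule eq_matI) (auto simp: endo_matrix_def)
  also have "det \<dots> = - 1"
    using endo_det_eq[OF e T] det by (subst det_transpose[of _ ?n]) (auto simp: endo_matrix_def)
  finally have z: "f (map e [0..<?n]) = 0" by simp
  have "map (\<lambda>i. \<Sum>j<?n. coord e (vs ! i) j *\<^sub>R e j) [0..<?n] = vs"
    unfolding coord_expand[OF e, symmetric] using map_nth[of vs] vs by simp
  then show ?thesis
    using alternating_form_det[OF f, where A = "\<lambda>i. coord e (vs ! i)" and n = ?n and e = e] z by simp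
qed

section \<open>Pullback of even forms\<close>

definition pullback_form :: "('v::real_vector \<Rightarrow> 'w::real_vector) \<Rightarrow> 'w even_form \<Rightarrow> 'v even_form" where
  "pullback_form T \<omega> = Even_Form (\<lambda>vs. eval_form \<omega> (map T vs))"

lemma eval_form_pullback:
  assumes T: "linear T"
  shows "eval_form (pullback_form T \<omega>) vs = eval_form \<omega> (map T vs)"
proof -
  have "linear (\<lambda>v. eval_form \<omega> (map T xs @ T v # map T ys))" for xs ys
    using linear_compose[OF T alternating_linear(1)[OF alternating_eval_form]]
    by (simp add: o_def)
  then have "alternating_form (\<lambda>vs. eval_form \<omega> (map T vs))"
    using alternating_linear(2)[OF alternating_eval_form[of \<omega>]]
    by (auto simp: alternating_form_def multilinear_form_def distinct_map)
  then show ?thesis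
    unfolding pullback_form_def by (subst Even_Form_inverse) (auto simp: eval_form_odd)
qed

text \<open>This is what carries the pullback through determinants and monomials. It is
  multiplicative because shuffles select positions only, and selecting positions commutes with
  \<open>map T\<close>.\<close>

lemma comm_ring_hom_pullback_form:
  assumes T: "linear T"
  shows "comm_ring_hom (pullback_form T)"
proof
  note ev = eval_form_pullback[OF T]
  show "pullback_form T (x + y) = pullback_form T x + pullback_form T y" for x y
    by (rule even_form_eqI) (simp add: ev eval_form_add)
  show "pullback_form T (x * y) = pullback_form T x * pullback_form T y" for x y
    by (rule even_form_eqI) (simp add: eval_form_times_fun ev wedge_def nths_map)
qed (rule even_form_eqI; simp add: eval_form_pullback[OF T] eval_form_one eval_form_zero unit_form_def)+

lemma pullback_form_scaleR:
  assumes "linear T"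
  shows "pullback_form T (c *\<^sub>R \<omega>) = c *\<^sub>R pullback_form T \<omega>"
  by (rule even_form_eqI) (simp add: eval_form_pullback[OF assms] eval_form_scaleR)

section \<open>Naturality of the Pontryagin forms\<close>

text \<open>Applying \<open>h\<close> to coefficients is a ring homomorphism of polynomials that
  fixes the variable, and ring homomorphisms commute with \<open>det\<close>.\<close>

lemma sigma_poly_hom:
  assumes "comm_ring_hom h"
  shows "sigma_poly m (map_mat h X) = h (sigma_poly m X)"
proof -
  interpret h: comm_ring_hom h by fact
  interpret ph: map_poly_comm_ring_hom h ..
  have "1\<^sub>m (dim_row X) + monom 1 1 \<cdot>\<^sub>m map_mat (\<lambda>a. [:a:]) (map_mat h X)
      = map_mat (map_poly h) (1\<^sub>m (dim_row X) + monom 1 1 \<cdot>\<^sub>m map_mat (\<lambda>a. [:a:]) X)"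
    if "dim_row X = dim_col X"
    using that
    by (intro eq_matI) (auto simp: ph.hom_add ph.hom_mult smult_monom map_poly_monom)
  note mat = this
  show ?thesis
  proof (cases "dim_row X = dim_col X")
    case True
    then show ?thesis
      unfolding sigma_poly_def index_map_mat mat[OF True]
        comm_ring_hom.hom_det[OF ph.comm_ring_hom_axioms]
      by simp
  next
    case False
    \<comment> \<open>\<open>det\<close> is 0 on non-square matrices by definition, so both sides
      vanish.\<close>
    then show ?thesis by (simp add: sigma_poly_def det_def)
  qed
qed

text \<open>Scaling \<open>X\<close> by \<open>c\<close> amounts to substituting \<open>c t\<close>
  for \<open>t\<close> in \<open>det(I + tX)\<close>, which multiplies the coefficient of
  \<open>t^m\<close> by \<open>c^m\<close>.\<close>

lemma sigma_poly_smult: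
  fixes X :: "'a::comm_ring_1 mat"
  assumes X: "X \<in> carrier_mat n n"
  shows "sigma_poly m (c \<cdot>\<^sub>m X) = c ^ m * sigma_poly m X"
proof -
  have hom: "comm_ring_hom (\<lambda>p. p \<circ>\<^sub>p [:0, c:])"
    by unfold_locales (simp_all add: pcompose_add pcompose_mult pcompose_1)
  have "1\<^sub>m n + monom 1 1 \<cdot>\<^sub>m map_mat (\<lambda>a. [:a:]) (c \<cdot>\<^sub>m X)
      = map_mat (\<lambda>p. p \<circ>\<^sub>p [:0, c:]) (1\<^sub>m n + monom 1 1 \<cdot>\<^sub>m map_mat (\<lambda>a. [:a:]) X)"
    using X
    by (intro eq_matI)
      (auto simp: pcompose_add pcompose_mult pcompose_pCons monom_Suc monom_0 mult_ac)
  then have "det (1\<^sub>m n + monom 1 1 \<cdot>\<^sub>m map_mat (\<lambda>a. [:a:]) (c \<cdot>\<^sub>m X))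
      = det (1\<^sub>m n + monom 1 1 \<cdot>\<^sub>m map_mat (\<lambda>a. [:a:]) X) \<circ>\<^sub>p [:0, c:]"
    by (simp only: comm_ring_hom.hom_det[OF hom])
  then show ?thesis
    using X by (simp add: sigma_poly_def coeff_pcompose_linear)
qed

text \<open>Two bases and a general factor \<open>c\<close> cover both later uses: an isometry, with
  \<open>e'\<close> its image of \<open>e\<close> and \<open>c\<close> a sign, and a homothety, with
  \<open>e' = e\<close> and \<open>c = 4\<close>.\<close>

lemma pullback_curvature_matrix:
  fixes e e' :: "nat \<Rightarrow> 'v::real_vector"
  assumes e: "is_basis e" and e': "is_basis e'" and g: "scalar_product_space g"
    and C: "algebraic_curvature_tensor C" and T: "linear T"
    and eq: "\<And>u v i j. j < dim (UNIV :: 'v set) \<Longrightarrow> coord e' (curv_op g C (T u) (T v) (e' i)) j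
      = c * coord e (curv_op g C u v (e i)) j"
  shows "map_mat (pullback_form T) (curvature_matrix e' g C)
    = of_real c \<cdot>\<^sub>m curvature_matrix e g C"
proof (rule eq_matI)
  fix i j
  assume "i < dim_row (of_real c \<cdot>\<^sub>m curvature_matrix e g C)"
    "j < dim_col (of_real c \<cdot>\<^sub>m curvature_matrix e g C)"
  then have ij: "i < dim (UNIV :: 'v set)" "j < dim (UNIV :: 'v set)"
    by (auto simp: curvature_matrix_def)
  let ?f = "\<lambda>u v. coord e (curv_op g C u v (e i)) j"
  let ?f' = "\<lambda>u v. coord e' (curv_op g C u v (e' i)) j"
  have "pullback_form T (two_form ?f') = c *\<^sub>R two_form ?f"
    by (rule even_form_eqI)
      (auto simp: eval_form_pullback[OF T] eval_form_scaleR eq ij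
        eval_two_form[OF alternating_bilinear_curvature[OF e g C]]
        eval_two_form[OF alternating_bilinear_curvature[OF e' g C]] split: list.splits)
  then show "map_mat (pullback_form T) (curvature_matrix e' g C) $$ (i, j)
      = (of_real c \<cdot>\<^sub>m curvature_matrix e g C) $$ (i, j)"
    using ij by (simp add: curvature_matrix_def scaleR_conv_of_real)
qed (simp_all add: curvature_matrix_def)

lemma pullback_pontryagin_form:
  fixes e e' :: "nat \<Rightarrow> 'v::real_vector"
  assumes e: "is_basis e" and e': "is_basis e'" and g: "scalar_product_space g"
    and C: "algebraic_curvature_tensor C" and T: "linear T"
    and eq: "\<And>u v i j. j < dim (UNIV :: 'v set) \<Longrightarrow> coord e' (curv_op g C (T u) (T v) (e' i)) j
      = c * coord e (curv_op g C u v (e i)) j"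
  shows "pullback_form T (pontryagin_form g C j) = c ^ (2 * j) *\<^sub>R pontryagin_form g C j"
proof -
  have "pullback_form T (sigma_poly (2 * j) (curvature_matrix e' g C))
      = sigma_poly (2 * j) (of_real c \<cdot>\<^sub>m curvature_matrix e g C)"
    by (simp only: sigma_poly_hom[OF comm_ring_hom_pullback_form[OF T], symmetric]
        pullback_curvature_matrix[OF assms])
  also have "\<dots> = c ^ (2 * j) *\<^sub>R sigma_poly (2 * j) (curvature_matrix e g C)"
    by (subst sigma_poly_smult[of _ "dim (UNIV :: 'v set)"])
      (simp_all add: curvature_matrix_def scaleR_conv_of_real)
  finally have "pullback_form T (sigma_poly (2 * j) (curvature_matrix e' g C))
      = c ^ (2 * j) *\<^sub>R sigma_poly (2 * j) (curvature_matrix e g C)" .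
  then show ?thesis
    \<comment> \<open>By basis independence, the form under the pullback is computed in
      \<open>e'\<close> and the one on the right in \<open>e\<close>.\<close>
    by (subst pontryagin_form_eq[OF e' g C], subst pontryagin_form_eq[OF e g C])
      (simp add: pullback_form_scaleR[OF T])
qed

lemma pullback_pontryagin_monomial:
  fixes e e' :: "nat \<Rightarrow> 'v::real_vector"
  assumes e: "is_basis e" and e': "is_basis e'" and g: "scalar_product_space g"
    and C: "algebraic_curvature_tensor C" and T: "linear T"
    and eq: "\<And>u v i j. j < dim (UNIV :: 'v set) \<Longrightarrow> coord e' (curv_op g C (T u) (T v) (e' i)) j
      = c * coord e (curv_op g C u v (e i)) j"
  shows "pullback_form T (pontryagin_monomial g C \<alpha>)
    = c ^ (2 * sum_list \<alpha>) *\<^sub>R pontryagin_monomial g C \<alpha>"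
proof -
  interpret comm_ring_hom "pullback_form T"
    by (rule comm_ring_hom_pullback_form[OF T])
  show ?thesis
    by (induction \<alpha>)
      (simp_all add: pontryagin_monomial_def hom_mult pullback_pontryagin_form[OF assms]
        power_add distrib_left)
qed

text \<open>Pulling back along the homothety by \<open>2\<close> reads off the degree of a homogeneous form.\<close>

lemma eval_pontryagin_monomial_degree:
  fixes g :: "'v::real_vector \<Rightarrow> 'v \<Rightarrow> real"
  assumes g: "scalar_product_space g" and C: "algebraic_curvature_tensor C"
    and len: "length vs \<noteq> 4 * sum_list \<alpha>"
  shows "eval_form (pontryagin_monomial g C \<alpha>) vs = 0"
proof -
  let ?T = "\<lambda>v::'v. 2 *\<^sub>R v"
  let ?\<omega> = "pontryagin_monomial g C \<alpha>"
  obtain e :: "nat \<Rightarrow> 'v" where e: "is_basis e"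
    using scalar_product_spaceD(1)[OF g] is_basis_exists by blast
  have T: "linear ?T" by (simp add: linear_iff algebra_simps)
  \<comment> \<open>Only the two form arguments are scaled, once each, while the basis vector stays;
    hence the factor is \<open>2 * 2\<close>.\<close>
  have "curv_op g C (?T u) (?T v) x = 4 *\<^sub>R curv_op g C u v x" for u v x
    using linear_scale[OF linear_curv_op(1)[OF g C]] linear_scale[OF linear_curv_op(2)[OF g C]]
    by simp
  then have "pullback_form ?T ?\<omega> = 4 ^ (2 * sum_list \<alpha>) *\<^sub>R ?\<omega>"
    by (intro pullback_pontryagin_monomial[OF e e g C T])
      (simp add: linear_scale[OF linear_coord[OF e]])
  then have "eval_form ?\<omega> (map ?T vs) = 4 ^ (2 * sum_list \<alpha>) * eval_form ?\<omega> vs"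
    using eval_form_pullback[OF T, of ?\<omega> vs] by (simp add: eval_form_scaleR)
  also have "(4::real) ^ (2 * sum_list \<alpha>) = (2 ^ 2) ^ (2 * sum_list \<alpha>)" by simp
  also have "\<dots> = 2 ^ (4 * sum_list \<alpha>)" by (simp only: power_mult[symmetric]) simp
  finally have 1: "eval_form ?\<omega> (map ?T vs) = 2 ^ (4 * sum_list \<alpha>) * eval_form ?\<omega> vs" .
  \<comment> \<open>The scalars are pulled out slot by slot; \<open>xs\<close> holds the arguments
    already passed.\<close>
  have "eval_form \<omega> (xs @ map ?T ys) = 2 ^ length ys * eval_form \<omega> (xs @ ys)"
    for \<omega> :: "'v even_form" and xs ys
  proof (induction ys arbitrary: xs)
    case (Cons y ys)
    then show ?case
      using Cons.IH[of "xs @ [?T y]"]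
        linear_scale[OF alternating_linear(1)[OF alternating_eval_form[of \<omega>]], of xs 2 y ys]
      by simp
  qed simp
  from this[of _ "[]"] 1 have "2 ^ length vs * eval_form ?\<omega> vs = 2 ^ (4 * sum_list \<alpha>) * eval_form ?\<omega> vs"
    by simp
  \<comment> \<open>The two scaling factors differ, so the value they multiply must be 0.\<close>
  moreover have "(2::real) ^ length vs \<noteq> 2 ^ (4 * sum_list \<alpha>)" using len by simp
  ultimately show ?thesis by simp
qed

section \<open>Isometries\<close>

text \<open>A vector in the kernel of \<open>T\<close> is orthogonal to everything, since
  \<open>g x y = g (T x) (T y)\<close>; nondegeneracy makes it 0.\<close>

lemma linear_isometry_inj:
  assumes "scalar_product_space g" "T \<in> linear_isometries g"
  shows "inj T"
proof -
  have T: "linear T" "\<And>x y. g (T x) (T y) = g x y"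
    using assms(2) by (auto simp: linear_isometries_def)
  have "x = 0" if "T x = 0" for x
    by (rule scalar_product_spaceD(5)[OF assms(1)])
      (metis T(2) that linear_0 scalar_product_spaceD(2)[OF assms(1)])
  then show ?thesis using linear_inj_iff_eq_0[OF T(1)] by blast
qed

lemma is_basis_comp:
  fixes e :: "nat \<Rightarrow> 'v::real_vector" and T :: "'v \<Rightarrow> 'v"
  assumes e: "is_basis e" and T: "linear T" "inj T"
  shows "is_basis (T \<circ> e)"
proof -
  let ?B = "e ` {..<dim (UNIV :: 'v set)}"
  have inj: "inj_on (T \<circ> e) {..<dim (UNIV :: 'v set)}"
    using is_basisD(1)[OF e] T(2) by (auto intro: comp_inj_on inj_on_subset)
  have ind: "independent (T ` ?B)"
    using linear_independent_injective_image[OF T(1) is_basisD(2)[OF e]] T(2)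
    by (auto intro: inj_on_subset)
  have "span (T ` ?B) = UNIV"
  proof (rule ccontr)
    \<comment> \<open>A vector outside the span would extend the image to an independent set of
      \<open>dim V + 1\<close> elements.\<close>
    assume "span (T ` ?B) \<noteq> UNIV"
    then obtain b where b: "b \<notin> span (T ` ?B)" by auto
    then have "card (insert b (T ` ?B)) \<le> card ?B"
      using independent_span_bound[of ?B "insert b (T ` ?B)"] is_basisD(3)[OF e] ind
      by (simp add: independent_insertI)
    moreover have "b \<notin> T ` ?B" using b span_base[of b "T ` ?B"] by metis
    moreover have "card (T ` ?B) = card ?B"
      by (rule card_image[OF inj_on_subset[OF T(2) subset_UNIV]])
    ultimately show False by simp
  qed
  then show ?thesis using inj ind by (simp add: is_basis_def image_comp)
qed

lemma coord_comp:
  fixes e :: "nat \<Rightarrow> 'v::real_vector" and T :: "'v \<Rightarrow> 'v"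
  assumes e: "is_basis e" and T: "linear T" "inj T" and j: "j < dim (UNIV :: 'v set)"
  shows "coord (T \<circ> e) (T v) j = coord e v j"
proof -
  have e': "is_basis (T \<circ> e)" by (rule is_basis_comp[OF assms(1-3)])
  have "linear (\<lambda>v. coord (T \<circ> e) (T v) j)"
    using linear_compose[OF T(1) linear_coord[OF e']] by (simp add: o_def)
  from coord_apply[OF e this, of v]
  have "coord (T \<circ> e) (T v) j
      = (\<Sum>i<dim (UNIV :: 'v set). coord e v i * coord (T \<circ> e) ((T \<circ> e) i) j)"
    by simp
  also have "\<dots> = (\<Sum>i<dim (UNIV :: 'v set). if i = j then coord e v i else 0)"
    using j by (intro sum.cong) (auto simp: coord_basis[OF e'] simp del: o_apply)
  finally show ?thesis using j by simp
qed

text \<open>The curvature vector is determined by its products with all \<open>y\<close>. As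
  \<open>T\<close> is onto, \<open>y = T z\<close>, and then both the isometry property and the
  scaling of \<open>C\<close> apply.\<close>

lemma curv_op_isometry:
  assumes g: "scalar_product_space g" and C: "algebraic_curvature_tensor C"
    and T: "T \<in> linear_isometries g"
    and eq: "\<And>u v x y. C (T u) (T v) (T x) (T y) = c * C u v x y"
  shows "curv_op g C (T u) (T v) (T x) = c *\<^sub>R T (curv_op g C u v x)"
proof (rule curv_op_eqI[OF g C])
  fix y
  have lin: "linear T" and iso: "g (T x) (T y) = g x y" for x y
    using T by (auto simp: linear_isometries_def)
  obtain e :: "nat \<Rightarrow> 'a" where e: "is_basis e"
    using scalar_product_spaceD(1)[OF g] is_basis_exists by blast
  have "range T = UNIV"
    using linear_span_image[OF lin, of "e ` {..<dim (UNIV :: 'a set)}"] is_basisD(3)[OF e]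
      is_basisD(3)[OF is_basis_comp[OF e lin linear_isometry_inj[OF g T]]]
    by (simp add: image_comp)
  then obtain z where "y = T z" by blast
  then show "g (c *\<^sub>R T (curv_op g C u v x)) y = C (T u) (T v) (T x) y"
    using eq by (simp add: linear_scale[OF scalar_product_spaceD(2)[OF g]] iso curv_op[OF g C])
qed

theorem theorem3p9:
  fixes g :: "'v::real_vector \<Rightarrow> 'v \<Rightarrow> real"
    and C :: "'v \<Rightarrow> 'v \<Rightarrow> 'v \<Rightarrow> 'v \<Rightarrow> real"
    and \<theta> :: "'v \<Rightarrow> 'v"
    and k :: nat
    and \<alpha> :: "nat list"
  assumes "k \<ge> 1"
    and "scalar_product_space g"
    and "dim (UNIV :: 'v set) = 4 * k"
    and "\<theta> \<in> linear_isometries g"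
    and "endo_det \<theta> = - 1"
    and "algebraic_curvature_tensor C"
    and "even_tensor \<theta> C \<or> odd_tensor \<theta> C"
    and "\<forall>a \<in> set \<alpha>. a \<ge> 1"
    and "sum_list \<alpha> = k"
  shows "pontryagin_monomial g C \<alpha> = 0"
proof (rule even_form_eqI)
  fix vs
  let ?\<omega> = "pontryagin_monomial g C \<alpha>"
  note g = assms(2) and C = assms(6)
  have \<theta>: "linear \<theta>" using assms(4) by (simp add: linear_isometries_def)
  have inj: "inj \<theta>" by (rule linear_isometry_inj[OF g assms(4)])
  obtain e :: "nat \<Rightarrow> 'v" where e: "is_basis e"
    using scalar_product_spaceD(1)[OF g] is_basis_exists by blast
  \<comment> \<open>The sign \<open>c\<close> treats the even and the odd case together.\<close>
  obtain c :: real where c: "c = 1 \<or> c = - 1"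
    and Cc: "\<And>u v x y. C (\<theta> u) (\<theta> v) (\<theta> x) (\<theta> y) = c * C u v x y"
  proof (cases "even_tensor \<theta> C")
    case True
    then show ?thesis by (intro that[of 1]) (simp_all add: even_tensor_def pullback4_def fun_eq_iff)
  next
    case False
    then show ?thesis
      using assms(7) by (intro that[of "- 1"]) (simp_all add: odd_tensor_def pullback4_def fun_eq_iff)
  qed
  have e': "is_basis (\<theta> \<circ> e)" by (rule is_basis_comp[OF e \<theta> inj])
  have "pullback_form \<theta> ?\<omega> = c ^ (2 * sum_list \<alpha>) *\<^sub>R ?\<omega>"
  proof (rule pullback_pontryagin_monomial[OF e e' g C \<theta>])
    fix u v :: 'v and i j
    assume j: "j < dim (UNIV :: 'v set)"
    have "curv_op g C (\<theta> u) (\<theta> v) (\<theta> (e i)) = c *\<^sub>R \<theta> (curv_op g C u v (e i))"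
      by (rule curv_op_isometry[OF g C assms(4)]) (rule Cc)
    then show "coord (\<theta> \<circ> e) (curv_op g C (\<theta> u) (\<theta> v) ((\<theta> \<circ> e) i)) j
        = c * coord e (curv_op g C u v (e i)) j"
      using coord_comp[OF e \<theta> inj j] linear_scale[OF linear_coord[OF e']] by simp
  qed
  \<comment> \<open>The exponent is even, so the sign of the odd case disappears.\<close>
  also have "c ^ (2 * sum_list \<alpha>) = 1" using c by auto
  finally have inv: "eval_form ?\<omega> (map \<theta> us) = eval_form ?\<omega> us" for us
    using eval_form_pullback[OF \<theta>, of ?\<omega> us] by simp
  show "eval_form ?\<omega> vs = eval_form 0 vs"
  \<comment> \<open>Equality of even forms concerns argument lists of every length. Length
    \<open>4 * k\<close> is top degree, where the determinant argument applies; other lengths vanish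
    by homogeneity.\<close>
  proof (cases "length vs = 4 * k")
    case True
    then show ?thesis
      using alternating_form_top_eq_0[where f = "eval_form ?\<omega>", OF alternating_eval_form e \<theta> assms(5) inv]
        assms(3)
      by (simp add: eval_form_zero)
  next
    case False
    then show ?thesis
      using eval_pontryagin_monomial_degree[OF g C] assms(9) by (simp add: eval_form_zero)
  qed
qed

end
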